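(* Let $p\ge 2$ be an integer, $\nu\in[0,1]$, let $\mathcal Z\subseteq\mathbb R^d$ be nonempty, closed and convex, and let $F:\mathcal Z\to\mathbb R^d$ be $(p-1)$-times differentiable on $\mathcal Z$. Suppose: (i) $\langle F(\mathbf z)-F(\mathbf u),\mathbf z-\mathbf u\rangle\ge 0$ for all $\mathbf z,\mathbf u\in\mathcal Z$; (ii) $D>0$ satisfies $\|\mathbf z-\mathbf u\|\le D$ for all $\mathbf z,\mathbf u\in\mathcal Z$; (iii) $\|\nabla^{p-1}F(\mathbf z)-\nabla^{p-1}F(\mathbf u)\|\le \mathcal H_{p,\nu}\|\mathbf z-\mathbf u\|^{\nu}$ for all $\mathbf z,\mathbf u\in\mathcal Z$, with $\mathcal H_{p,\nu}<\infty$. Let $\epsilon>0$, $\mathbf z_0\in\mathcal Z$, $K\ge1$, and $H_0\in\big(0,\inf_{\nu'\in[0,1]}\mathcal M_{p,\nu'}(\epsilon)\big]$, and run the universal tensor extragradient method (UTEG) described in the context. (a) Assume that the generated trial points satisfy $$\max_{\mathbf u\in\mathcal Z}\langle F(\mathbf z_{k,i}),\mathbf z_{k,i}-\mathbf u\rangle\ge\epsilon,\qquad i=0,\dots,i_k,\quad k=0,\dots,K-1.$$ Then the output $\bar{\mathbf z}_K$ satisfies $$m(\bar{\mathbf z}_K)\le O\!\left(\frac{\mathcal M_{p,\nu}(\epsilon)D^{p+1}}{K^{(p+1)/2}}\right),$$ and, making the dependence on $\epsilon$ explicit, $$m(\bar{\mathbf z}_K)\le O\!\left(\frac{\mathcal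 H_{p,\nu}^{p/(p-1+\nu)}D^{p+1+(1-\nu)/(p-1+\nu)}}{\epsilon^{(1-\nu)/(p-1+\nu)}K^{(p+1)/2}}\right),$$ where the $O(\cdot)$ in these two bounds hides constants depending only on $p$ and $\nu$. (b) Consequently, for any fixed admissible $H_0>0$ and a suitable choice of $K$, after at most $$O\!\left(\mathcal H_{p,\nu}^{2p/((p+1)(p-1+\nu))}D^{2+2(1-\nu)/((p+1)(p-1+\nu))}\epsilon^{-2p/((p+1)(p-1+\nu))}\right)$$ tensor-oracle calls, either an $\epsilon$-weak solution appears among the generated trial points $\mathbf z_{k,i}$ or the averaged output $\bar{\mathbf z}_K$ is an $\epsilon$-weak solution.
   Context: $\|\cdot\|$ is the Euclidean norm on vectors and the induced spectral (operator) norm on (multi)linear maps. Weak gap: $m(\mathbf z)=\max_{\mathbf u\in\mathcal Z}\langle F(\mathbf u),\mathbf z-\mathbf u\rangle$. A point $\bar{\mathbf z}\in\mathcal Z$ is an $\epsilon$-weak solution if $m(\bar{\mathbf z})\le\epsilon$. For an operator $G:\mathcal Z\to\mathbb R^d$, $\mathrm{VI}_{\mathcal Z}(G)=\{\mathbf z^*\in\mathcal Z:\langle G(\mathbf z^* ),\mathbf z-\mathbf z^*\rangle\ge0\ \text{for all }\mathbf z\in\mathcal Z\}$. Taylor model: $\bar F_p(\mathbf u;\mathbf z)=\sum_{i=0}^{p-1}\frac1{i!}\nabla^iF(\mathbf z)[\mathbf u-\mathbf z]^i$. For $H>0$, $T_p(\mathbf z;1,H)$ denotes a solution (any selection) of the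 regularized model variational inequality with regularization exponent $p-1$: $T_p(\mathbf z;1,H)\in\mathrm{VI}_{\mathcal Z}(\bar F_{p,1,H}(\cdot;\mathbf z))$, where $\bar F_{p,1,H}(\mathbf u;\mathbf z)=\bar F_p(\mathbf u;\mathbf z)+H\|\mathbf u-\mathbf z\|^{p-1}(\mathbf u-\mathbf z)$. Constants: for $\nu'\in[0,1]$, $C_{p,\nu'}=\frac1{(p-2)!}\int_0^1(1-t)^{p-2}t^{\nu'}\,dt$; $\mathcal H_{p,\nu'}\in[0,\infty]$ is a Hölder constant of $\nabla^{p-1}F$ on $\mathcal Z$ with exponent $\nu'$ (that is, $\|\nabla^{p-1}F(\mathbf z)-\nabla^{p-1}F(\mathbf u)\|\le\mathcal H_{p,\nu'}\|\mathbf z-\mathbf u\|^{\nu'}$ for all $\mathbf z,\mathbf u\in\mathcal Z$, with $\mathcal H_{p,\nu'}=\infty$ if there is no finite constant); and for $\delta>0$ $$\mathcal M_{p,\nu'}(\delta)=2C_{p,\nu'}\mathcal H_{p,\nu'}\left(\frac{3DC_{p,\nu'}\mathcal H_{p,\nu'}}{\delta}\right)^{(1-\nu')/(p-1+\nu')},$$ with $\mathcal M_{p,\nu'}(\delta)=\infty$ if $\mathcal H_{p,\nu'}=\infty$, and the convention that a zero exponent gives $1$. "Admissible" $H_0$ means $H_0\in(0,\inf_{\nu'\in[0,1]}\mathcal M_{p,\nu'}(\epsilon)]$. UTEG (with input $\mathbf z_0$, $p$, $\epsilon$, $K$, $H_0$): for $k=0,\dots,K-1$: write $\mathbf z_{k,i}=T_p(\mathbf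 z_k;1,H_k2^i)$ (the trial points, generated successively for $i=0,1,\dots$) and find the smallest integer $i_k\ge0$ such that $\|F(\mathbf z_{k,i_k})-\bar F_p(\mathbf z_{k,i_k};\mathbf z_k)\|\le H_k2^{i_k-1}\|\mathbf z_{k,i_k}-\mathbf z_k\|^{p}$; set $M_k=H_k2^{i_k}$, $\mathbf z_{k+1/2}=\mathbf z_{k,i_k}$, $\gamma_k=M_k\|\mathbf z_{k+1/2}-\mathbf z_k\|^{p-1}$; $\mathbf z_{k+1}=\arg\min_{\mathbf z\in\mathcal Z}\{\langle F(\mathbf z_{k+1/2}),\mathbf z-\mathbf z_k\rangle+\frac{\gamma_k}2\|\mathbf z-\mathbf z_k\|^2\}$; $H_{k+1}=M_k/2$. Output: $\bar{\mathbf z}_K=\big(\sum_{k=0}^{K-1}\gamma_k^{-1}\mathbf z_{k+1/2}\big)/\big(\sum_{k=0}^{K-1}\gamma_k^{-1}\big)$. The condition in (a) is imposed on every trial point generated while the line searches are carried out. One tensor-oracle call is one evaluation of a point $T_p(\cdot;1,\cdot)$, i.e. the generation of one trial point; thus a completed iteration $k$ uses $i_k+1$ calls. The $O(\cdot)$ in the complexity bound (b) hides a constant depending only on $p,\nu$ and is understood as $\epsilon\to0$ with the problem data and input ($F,\mathcal Z,D,p,\nu,\mathcal H_{p,\nu},\mathbf z_0,H_0$) fixed, i.e. the bound holds for all sufficiently small $\epsilon>0$. *)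

theory Defs
  imports "HOL-Analysis.Analysis"
begin

text \<open>
  The hidden constants of the theorem depend on neither the dimension \<open>d\<close> nor the problem data,
  so \<open>d\<close> has to be quantified inside the statement, below those constants.  We therefore use one
  inner product space, the finitely supported real sequences, whose subspaces
  \<open>Rd d = {x. x\<^sub>i = 0 for all i \<ge> d}\<close> are the Euclidean spaces of all dimensions with their
  standard inner product and norm.
\<close>

typedef fsv = "{x :: nat \<Rightarrow> real. finite {i. x i \<noteq> 0}}"
  morphisms coord Abs_fsv
  by (rule exI[of _ "\<lambda>_. 0"]) simp

setup_lifting type_definition_fsv

lemma finite_coord [simp]: "finite {i. coord x i \<noteq> 0}"
  using coord[of x] by simp

lemma fsv_eqI: "(\<And>i. coord x i = coord y i) \<Longrightarrow> x = y"
  by (meson coord_inject ext)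

instantiation fsv :: real_vector
begin

lift_definition zero_fsv :: fsv is "\<lambda>_. 0" by simp

lift_definition plus_fsv :: "fsv \<Rightarrow> fsv \<Rightarrow> fsv" is "\<lambda>x y i. x i + y i"
proof -
  fix x y :: "nat \<Rightarrow> real"
  assume "finite {i. x i \<noteq> 0}" "finite {i. y i \<noteq> 0}"
  then show "finite {i. x i + y i \<noteq> 0}"
    by (auto intro: finite_subset[OF _ finite_UnI[of "{i. x i \<noteq> 0}" "{i. y i \<noteq> 0}"]])
qed

lift_definition uminus_fsv :: "fsv \<Rightarrow> fsv" is "\<lambda>x i. - x i" by simp

lift_definition minus_fsv :: "fsv \<Rightarrow> fsv \<Rightarrow> fsv" is "\<lambda>x y i. x i - y i"
proof -
  fix x y :: "nat \<Rightarrow> real"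
  assume "finite {i. x i \<noteq> 0}" "finite {i. y i \<noteq> 0}"
  then show "finite {i. x i - y i \<noteq> 0}"
    by (auto intro: finite_subset[OF _ finite_UnI[of "{i. x i \<noteq> 0}" "{i. y i \<noteq> 0}"]])
qed

lift_definition scaleR_fsv :: "real \<Rightarrow> fsv \<Rightarrow> fsv" is "\<lambda>c x i. c * x i"
proof -
  fix c :: real and x :: "nat \<Rightarrow> real"
  assume "finite {i. x i \<noteq> 0}"
  then show "finite {i. c * x i \<noteq> 0}"
    by (rule rev_finite_subset) auto
qed

instance
proof
qed (rule fsv_eqI; simp add: zero_fsv.rep_eq plus_fsv.rep_eq uminus_fsv.rep_eq
       minus_fsv.rep_eq scaleR_fsv.rep_eq algebra_simps)+

end

lemmas coord_simps [simp] =
  zero_fsv.rep_eq plus_fsv.rep_eq uminus_fsv.rep_eq minus_fsv.rep_eq scaleR_fsv.rep_eq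

instantiation fsv :: real_inner
begin

definition inner_fsv :: "fsv \<Rightarrow> fsv \<Rightarrow> real"
  where "inner_fsv x y = (\<Sum>i | coord x i \<noteq> 0. coord x i * coord y i)"

definition norm_fsv :: "fsv \<Rightarrow> real"
  where "norm_fsv x = sqrt (inner x x)"

definition dist_fsv :: "fsv \<Rightarrow> fsv \<Rightarrow> real"
  where "dist_fsv x y = norm (x - y)"

definition sgn_fsv :: "fsv \<Rightarrow> fsv"
  where "sgn_fsv x = x /\<^sub>R norm x"

definition uniformity_fsv :: "(fsv \<times> fsv) filter"
  where "uniformity_fsv = (INF e\<in>{0<..}. principal {(x, y). dist x y < e})"

definition open_fsv :: "fsv set \<Rightarrow> bool"
  where "open_fsv U = (\<forall>x\<in>U. \<forall>\<^sub>F (x', y) in uniformity. x' = x \<longrightarrow> y \<in> U)"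

lemma inner_fsv_superset:
  assumes "finite A" "{i. coord x i \<noteq> 0} \<subseteq> A"
  shows "inner x y = (\<Sum>i\<in>A. coord x i * coord y i)"
  unfolding inner_fsv_def using assms by (intro sum.mono_neutral_left) auto

instance
proof
  fix x y z :: fsv and r :: real
  let ?A = "{i. coord x i \<noteq> 0} \<union> {i. coord y i \<noteq> 0}"
  have A: "finite ?A" by simp
  have x: "inner x w = (\<Sum>i\<in>?A. coord x i * coord w i)" for w
    by (rule inner_fsv_superset[OF A]) auto
  have y: "inner y w = (\<Sum>i\<in>?A. coord y i * coord w i)" for w
    by (rule inner_fsv_superset[OF A]) auto
  have xy: "inner (x + y) w = (\<Sum>i\<in>?A. coord (x + y) i * coord w i)" for w
    by (rule inner_fsv_superset[OF A]) auto
  have rx: "inner (r *\<^sub>R x) w = (\<Sum>i\<in>?A. coord (r *\<^sub>R x) i * coord w i)" for w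
    by (rule inner_fsv_superset[OF A]) auto
  show "inner x y = inner y x" by (simp add: x y mult.commute)
  show "inner (x + y) z = inner x z + inner y z"
    by (simp add: x y xy algebra_simps sum.distrib)
  show "inner (r *\<^sub>R x) y = r * inner x y"
    by (simp add: x rx sum_distrib_left mult.assoc)
  show "0 \<le> inner x x" by (simp add: inner_fsv_def sum_nonneg)
  show "inner x x = 0 \<longleftrightarrow> x = 0"
  proof
    assume "inner x x = 0"
    then have "\<forall>i\<in>{i. coord x i \<noteq> 0}. coord x i * coord x i = 0"
      unfolding inner_fsv_def by (subst (asm) sum_nonneg_eq_0_iff) auto
    then show "x = 0" by (intro fsv_eqI) auto
  qed (simp add: inner_fsv_def)
qed (simp_all add: norm_fsv_def dist_fsv_def sgn_fsv_def uniformity_fsv_def open_fsv_def)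

end

definition Rd :: "nat \<Rightarrow> fsv set"
  where "Rd d = {x. \<forall>i\<ge>d. coord x i = 0}"

lift_definition proj :: "nat \<Rightarrow> fsv \<Rightarrow> fsv" is "\<lambda>d x i. if i < d then x i else 0"
proof -
  fix d and x :: "nat \<Rightarrow> real"
  show "finite {i. (if i < d then x i else 0) \<noteq> 0}"
    by (rule finite_subset[of _ "{..<d}"]) auto
qed

text \<open>
  An \<open>m\<close>-linear map on \<open>Rd d\<close> with values in \<open>Rd d\<close> is a function on lists of \<open>m\<close> vectors;
  only its values on lists of length \<open>m\<close> with entries in \<open>Rd d\<close> matter.
\<close>

definition multilin :: "nat \<Rightarrow> nat \<Rightarrow> (fsv list \<Rightarrow> fsv) \<Rightarrow> bool"
  where "multilin d m A \<longleftrightarrow>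
    (\<forall>hs \<in> lists (Rd d). length hs = m \<longrightarrow> A hs \<in> Rd d) \<and>
    (\<forall>xs \<in> lists (Rd d). \<forall>ys \<in> lists (Rd d). length xs + 1 + length ys = m \<longrightarrow>
      (\<forall>v \<in> Rd d. \<forall>w \<in> Rd d. \<forall>a b :: real.
        A (xs @ (a *\<^sub>R v + b *\<^sub>R w) # ys) = a *\<^sub>R A (xs @ v # ys) + b *\<^sub>R A (xs @ w # ys)))"

definition opnorm :: "nat \<Rightarrow> nat \<Rightarrow> (fsv list \<Rightarrow> fsv) \<Rightarrow> real"
  where "opnorm d m A =
    (SUP hs \<in> {hs \<in> lists (Rd d). length hs = m \<and> (\<forall>h\<in>set hs. norm h \<le> 1)}. norm (A hs))"

text \<open>
  \<open>derivs d Z F m DF\<close>: \<open>F : Z \<rightarrow> Rd d\<close> is \<open>m\<close>-times differentiable on \<open>Z\<close>, with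
  \<open>DF i z [h\<^sub>1, \<dots>, h\<^sub>i]\<close> the \<open>i\<close>-th derivative of \<open>F\<close> at \<open>z\<close>.  Derivatives are Frechet derivatives
  within \<open>Z\<close>, taken for each fixed list of arguments \<open>hs\<close> (equivalent in finite dimension to the
  operator norm).  They are carried as data because they are not unique if \<open>Z\<close> has empty
  interior.  The projection only extends the linear map \<open>h \<mapsto> DF (Suc i) z (h # hs)\<close> from \<open>Rd d\<close> to
  the whole type, as \<open>has_derivative\<close> requires.
\<close>

definition derivs ::
    "nat \<Rightarrow> fsv set \<Rightarrow> (fsv \<Rightarrow> fsv) \<Rightarrow> nat \<Rightarrow> (nat \<Rightarrow> fsv \<Rightarrow> fsv list \<Rightarrow> fsv) \<Rightarrow> bool"
  where "derivs d Z F m DF \<longleftrightarrow>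
    (\<forall>z\<in>Z. DF 0 z [] = F z) \<and>
    (\<forall>i\<le>m. \<forall>z\<in>Z. multilin d i (DF i z)) \<and>
    (\<forall>i<m. \<forall>z\<in>Z. \<forall>hs \<in> lists (Rd d). length hs = i \<longrightarrow>
      ((\<lambda>x. DF i x hs) has_derivative (\<lambda>h. DF (Suc i) z (proj d h # hs))) (at z within Z))"

text \<open>The maxima over \<open>Z\<close> defining the weak gap and the (strong) gap of the trial points are written
  as suprema; in the theorem \<open>Z\<close> is compact and \<open>F\<close> continuous on it, so they are attained.\<close>

definition weak_gap :: "fsv set \<Rightarrow> (fsv \<Rightarrow> fsv) \<Rightarrow> fsv \<Rightarrow> real"
  where "weak_gap Z F z = (SUP u\<in>Z. inner (F u) (z - u))"

definition strong_gap :: "fsv set \<Rightarrow> (fsv \<Rightarrow> fsv) \<Rightarrow> fsv \<Rightarrow> real"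
  where "strong_gap Z F z = (SUP u\<in>Z. inner (F z) (z - u))"

definition weak_solution :: "fsv set \<Rightarrow> (fsv \<Rightarrow> fsv) \<Rightarrow> real \<Rightarrow> fsv \<Rightarrow> bool"
  where "weak_solution Z F \<epsilon> z \<longleftrightarrow> z \<in> Z \<and> weak_gap Z F z \<le> \<epsilon>"

definition VI :: "fsv set \<Rightarrow> (fsv \<Rightarrow> fsv) \<Rightarrow> fsv set"
  where "VI Z G = {zs \<in> Z. \<forall>z\<in>Z. inner (G zs) (z - zs) \<ge> 0}"

definition taylor_model ::
    "nat \<Rightarrow> (nat \<Rightarrow> fsv \<Rightarrow> fsv list \<Rightarrow> fsv) \<Rightarrow> fsv \<Rightarrow> fsv \<Rightarrow> fsv"
  where "taylor_model p DF z u = (\<Sum>i<p. (1 / fact i) *\<^sub>R DF i z (replicate i (u - z)))"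

definition reg_model ::
    "nat \<Rightarrow> (nat \<Rightarrow> fsv \<Rightarrow> fsv list \<Rightarrow> fsv) \<Rightarrow> real \<Rightarrow> fsv \<Rightarrow> fsv \<Rightarrow> fsv"
  where "reg_model p DF H z u =
    taylor_model p DF z u + (H * norm (u - z) ^ (p - 1)) *\<^sub>R (u - z)"

text \<open>A selection \<open>T z H\<close> of solutions of the regularized model variational inequality.\<close>

definition model_solver ::
    "fsv set \<Rightarrow> nat \<Rightarrow> (nat \<Rightarrow> fsv \<Rightarrow> fsv list \<Rightarrow> fsv) \<Rightarrow> (fsv \<Rightarrow> real \<Rightarrow> fsv) \<Rightarrow> bool"
  where "model_solver Z p DF T \<longleftrightarrow> (\<forall>z\<in>Z. \<forall>H>0. T z H \<in> VI Z (reg_model p DF H z))"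

text \<open>The value of the integrand at \<open>t = 0\<close> (where \<open>0 powr 0 = 0\<close>) is irrelevant.\<close>

definition C_const :: "nat \<Rightarrow> real \<Rightarrow> real"
  where "C_const p \<nu> = 1 / fact (p - 2) * integral {0..1} (\<lambda>t. (1 - t) ^ (p - 2) * t powr \<nu>)"

text \<open>
  \<open>Hc \<nu>\<close> is a Hoelder constant of exponent \<open>\<nu>\<close>; where no finite constant exists, the inequality
  forces \<open>Hc \<nu> = \<infinity>\<close>.  For \<open>u = z\<close> the left-hand side is \<open>0\<close>, so neither \<open>0 powr 0 = 0\<close> nor
  \<open>\<infinity> * 0 = 0\<close> interferes.
\<close>

definition holder_constants ::
    "nat \<Rightarrow> fsv set \<Rightarrow> nat \<Rightarrow> (nat \<Rightarrow> fsv \<Rightarrow> fsv list \<Rightarrow> fsv) \<Rightarrow> (real \<Rightarrow> ennreal) \<Rightarrow> bool"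
  where "holder_constants d Z p DF Hc \<longleftrightarrow>
    (\<forall>\<nu>\<in>{0..1}. \<forall>z\<in>Z. \<forall>u\<in>Z.
      ennreal (opnorm d (p - 1) (\<lambda>hs. DF (p - 1) z hs - DF (p - 1) u hs))
        \<le> Hc \<nu> * ennreal (norm (z - u) powr \<nu>))"

definition M_const :: "nat \<Rightarrow> real \<Rightarrow> (real \<Rightarrow> ennreal) \<Rightarrow> real \<Rightarrow> real \<Rightarrow> ennreal"
  where "M_const p D Hc \<delta> \<nu> =
    (if Hc \<nu> = \<infinity> then \<infinity>
     else let CH = C_const p \<nu> * enn2real (Hc \<nu>); e = (1 - \<nu>) / (real p - 1 + \<nu>)
          in ennreal (2 * CH * (if e = 0 then 1 else (3 * D * CH / \<delta>) powr e)))"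

definition admissible :: "nat \<Rightarrow> real \<Rightarrow> (real \<Rightarrow> ennreal) \<Rightarrow> real \<Rightarrow> real \<Rightarrow> bool"
  where "admissible p D Hc \<epsilon> H0 \<longleftrightarrow> 0 < H0 \<and> ennreal H0 \<le> (INF \<nu>\<in>{0..1}. M_const p D Hc \<epsilon> \<nu>)"

text \<open>
  The universal tensor extragradient method.  The run depends neither on \<open>\<epsilon>\<close> nor on \<open>K\<close>, so it is
  described as an infinite sequence of states \<open>(z\<^sub>k, H\<^sub>k)\<close>.  The values at iteration \<open>k\<close> are only
  meaningful if the line searches of the iterations before \<open>k\<close> terminate, and those derived from
  \<open>i\<^sub>k\<close> only if the line search of iteration \<open>k\<close> terminates too.
\<close>

locale uteg =
  fixes Z :: "fsv set" and p :: nat and F :: "fsv \<Rightarrow> fsv"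
    and DF :: "nat \<Rightarrow> fsv \<Rightarrow> fsv list \<Rightarrow> fsv"
    and T :: "fsv \<Rightarrow> real \<Rightarrow> fsv" and z0 :: fsv and H0 :: real
begin

definition accepts :: "fsv \<Rightarrow> real \<Rightarrow> nat \<Rightarrow> bool"
  where "accepts z H i \<longleftrightarrow>
    (let y = T z (H * 2 ^ i)
     in norm (F y - taylor_model p DF z y) \<le> H * 2 powi (int i - 1) * norm (y - z) ^ p)"

definition search :: "fsv \<Rightarrow> real \<Rightarrow> nat"
  where "search z H = (LEAST i. accepts z H i)"

primrec state :: "nat \<Rightarrow> fsv \<times> real"
  where
    "state 0 = (z0, H0)"
  | "state (Suc k) =
      (let z = fst (state k); H = snd (state k);
           M = H * 2 ^ search z H;
           y = T z M;
           \<gamma> = M * norm (y - z) ^ (p - 1)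
       in (arg_min_on (\<lambda>x. inner (F y) (x - z) + \<gamma> / 2 * (norm (x - z))\<^sup>2) Z, M / 2))"

definition zk :: "nat \<Rightarrow> fsv" where "zk k = fst (state k)"
definition Hk :: "nat \<Rightarrow> real" where "Hk k = snd (state k)"
definition ik :: "nat \<Rightarrow> nat" where "ik k = search (zk k) (Hk k)"
definition Mk :: "nat \<Rightarrow> real" where "Mk k = Hk k * 2 ^ ik k"
definition trial :: "nat \<Rightarrow> nat \<Rightarrow> fsv" where "trial k i = T (zk k) (Hk k * 2 ^ i)"
definition zhalf :: "nat \<Rightarrow> fsv" where "zhalf k = trial k (ik k)"
definition \<gamma>k :: "nat \<Rightarrow> real" where "\<gamma>k k = Mk k * norm (zhalf k - zk k) ^ (p - 1)"

definition terminates :: "nat \<Rightarrow> bool"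
  where "terminates k \<longleftrightarrow> (\<exists>i. accepts (zk k) (Hk k) i)"

text \<open>The trial points actually generated: \<open>i = 0, \<dots>, i\<^sub>k\<close> if line search \<open>k\<close> terminates, and all
  \<open>i\<close> if it is reached but does not terminate.\<close>

definition generated :: "nat \<Rightarrow> nat \<Rightarrow> bool"
  where "generated k i \<longleftrightarrow> (\<forall>j<k. terminates j) \<and> (\<forall>i'<i. \<not> accepts (zk k) (Hk k) i')"

text \<open>Number of oracle calls used by the iterations before \<open>k\<close>.\<close>

definition calls :: "nat \<Rightarrow> nat"
  where "calls k = (\<Sum>j<k. ik j + 1)"

definition average :: "nat \<Rightarrow> fsv"
  where "average K = (\<Sum>k<K. inverse (\<gamma>k k) *\<^sub>R zhalf k) /\<^sub>R (\<Sum>k<K. inverse (\<gamma>k k))"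

end

end

theory Submission
  imports Defs "HOL-Real_Asymp.Real_Asymp"
begin

text \<open>
  A rejected trial point has a gap of at least \<open>\<epsilon>\<close>, which keeps it away from the prox centre; since
  Taylor's formula bounds the model error by a power of that distance, rejection forces the
  regularization constant below \<open>M\<^sub>\<nu>(\<epsilon>)\<close>.  Hence all \<open>M\<^sub>k\<close> are at most \<open>2 M\<^sub>\<nu>(\<epsilon>)\<close>.  The
  extragradient inequality, weighted by \<open>1 / \<gamma>\<^sub>k\<close> and summed, bounds both the weak gap of the average
  by \<open>D\<^sup>2 / (2 \<Sum> 1 / \<gamma>\<^sub>k)\<close> and the sum of the squared step lengths \<open>r\<^sub>k\<close> by \<open>2 D\<^sup>2\<close>.  As
  \<open>\<gamma>\<^sub>k \<le> 2 M\<^sub>\<nu>(\<epsilon>) r\<^sub>k\<^bsup>p-1\<^esup>\<close>, the power mean inequality gives \<open>\<Sum> 1 / \<gamma>\<^sub>k \<ge> c K\<^bsup>(p+1)/2\<^esup>\<close>.  The oracle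
  calls telescope, because \<open>H\<^sub>k\<^sub>+\<^sub>1 = H\<^sub>k 2\<^bsup>i\<^sub>k - 1\<^esup>\<close> makes \<open>i\<^sub>k + 1 = 2 + log\<^sub>2 (H\<^sub>k\<^sub>+\<^sub>1 / H\<^sub>k)\<close>.
\<close>

section \<open>Finite-dimensional subspaces and multilinear maps\<close>

lift_definition unit_fsv :: "nat \<Rightarrow> fsv" is "\<lambda>j i. if i = j then 1 else 0"
  by simp

lemma coord_sum: "coord (sum f A) i = (\<Sum>a\<in>A. coord (f a) i)"
  by (induction A rule: infinite_finite_induct) auto

lemma Rd_expansion: "x = (\<Sum>j<d. coord x j *\<^sub>R unit_fsv j)" if "x \<in> Rd d"
proof (rule fsv_eqI)
  fix i
  have "(\<Sum>j<d. coord x j * (if i = j then 1 else 0)) = (if i < d then coord x i else 0)"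
    by (simp add: if_distrib[of "\<lambda>y. _ * y"] cong: if_cong)
  then show "coord x i = coord (\<Sum>j<d. coord x j *\<^sub>R unit_fsv j) i"
    using that by (auto simp: coord_sum unit_fsv.rep_eq Rd_def)
qed

lemma unit_fsv_in_Rd: "unit_fsv j \<in> Rd d" if "j < d"
  using that by (auto simp: Rd_def unit_fsv.rep_eq)

lemma Rd_add: "x \<in> Rd d \<Longrightarrow> y \<in> Rd d \<Longrightarrow> x + y \<in> Rd d"
  and Rd_diff: "x \<in> Rd d \<Longrightarrow> y \<in> Rd d \<Longrightarrow> x - y \<in> Rd d"
  and Rd_scaleR: "x \<in> Rd d \<Longrightarrow> c *\<^sub>R x \<in> Rd d"
  and Rd_zero: "0 \<in> Rd d"
  by (auto simp: Rd_def)

lemma Rd_sum: "(\<And>a. a \<in> A \<Longrightarrow> f a \<in> Rd d) \<Longrightarrow> sum f A \<in> Rd d"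
  by (induction A rule: infinite_finite_induct) (auto simp: Rd_add Rd_zero)

lemma proj_Rd: "x \<in> Rd d \<Longrightarrow> proj d x = x"
  by (rule fsv_eqI) (auto simp: proj.rep_eq Rd_def)

lemma abs_coord_le_norm: "\<bar>coord x j\<bar> \<le> norm x"
proof -
  have "coord x j * coord x j \<le> (\<Sum>i\<in>insert j {i. coord x i \<noteq> 0}. coord x i * coord x i)"
    by (rule member_le_sum) auto
  also have "\<dots> = inner x x"
    by (rule inner_fsv_superset[symmetric]) auto
  finally have "(coord x j)\<^sup>2 \<le> (norm x)\<^sup>2"
    unfolding power2_norm_eq_inner by (simp add: power2_eq_square)
  then show ?thesis
    using abs_le_square_iff[of "coord x j" "norm x"] by simp
qed

text \<open>The type is infinite-dimensional, so compactness has to come from the dimension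
  \<open>d\<close>. Induction on \<open>d\<close> adds a segment along the next unit vector to the
  compact set obtained so far. The induction bounds coordinates, because such a bound passes to a
  vector whose last coordinate is set to zero.\<close>

lemma bounded_Rd_subset_compact: "\<exists>K. compact K \<and> {x \<in> Rd d. norm x \<le> B} \<subseteq> K"
proof -
  have "\<exists>K. compact K \<and> (\<forall>x \<in> Rd d. (\<forall>i. \<bar>coord x i\<bar> \<le> B) \<longrightarrow> x \<in> K)"
  proof (induction d)
    case 0
    have "x = 0" if "x \<in> Rd 0" for x
      using that by (intro fsv_eqI) (auto simp: Rd_def)
    then show ?case by (intro exI[of _ "{0}"]) auto
  next
    case (Suc d)
    then obtain K where K: "compact K" "\<And>x. x \<in> Rd d \<Longrightarrow> (\<And>i. \<bar>coord x i\<bar> \<le> B) \<Longrightarrow> x \<in> K"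
      by blast
    let ?I = "(\<lambda>t. t *\<^sub>R unit_fsv d) ` {-B..B}"
    have "compact ?I"
      by (intro compact_continuous_image continuous_intros) auto
    then have "compact {x + y |x y. x \<in> K \<and> y \<in> ?I}"
      using K(1) compact_sums by blast
    moreover have "x \<in> {x + y |x y. x \<in> K \<and> y \<in> ?I}"
      if x: "x \<in> Rd (Suc d)" "\<And>i. \<bar>coord x i\<bar> \<le> B" for x
    proof -
      let ?y = "coord x d *\<^sub>R unit_fsv d"
      \<comment> \<open>The coordinate that becomes zero in \<open>x - ?y\<close> must still obey
        the bound \<open>B\<close>.\<close>
      have "B \<ge> 0" using x(2)[of 0] by linarith
      then have "x - ?y \<in> K"
        using x by (intro K(2)) (auto simp: Rd_def unit_fsv.rep_eq)
      moreover have "?y \<in> ?I"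
        using x(2)[of d] by (intro imageI) (simp add: abs_le_iff)
      moreover have "x = (x - ?y) + ?y" by simp
      ultimately show ?thesis by blast
    qed
    ultimately show ?case by blast
  qed
  then show ?thesis
    using abs_coord_le_norm order_trans by (smt (verit) mem_Collect_eq subsetI)
qed

lemma compact_in_Rd:
  assumes "closed Z" "Z \<subseteq> Rd d" "bounded Z"
  shows "compact Z"
proof -
  obtain B where "\<forall>x\<in>Z. norm x \<le> B"
    using assms(3) by (auto simp: bounded_iff)
  moreover obtain K where "compact K" "{x \<in> Rd d. norm x \<le> B} \<subseteq> K"
    using bounded_Rd_subset_compact by blast
  ultimately have "Z = K \<inter> Z" "compact (K \<inter> Z)"
    using assms compact_Int_closed by blast+
  then show ?thesis by simp
qed

lemma multilin_Cons:
  assumes "multilin d (Suc m) A" "v \<in> Rd d"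
  shows "multilin d m (\<lambda>hs. A (v # hs))"
  unfolding multilin_def
proof (intro conjI ballI impI allI)
  fix hs assume "hs \<in> lists (Rd d)" "length hs = m"
  then show "A (v # hs) \<in> Rd d"
    using assms unfolding multilin_def by auto
next
  fix xs ys x w and a b :: real
  assume *: "xs \<in> lists (Rd d)" "ys \<in> lists (Rd d)" "length xs + 1 + length ys = m"
    "x \<in> Rd d" "w \<in> Rd d"
  then have "v # xs \<in> lists (Rd d)" "length (v # xs) + 1 + length ys = Suc m"
    using assms(2) by auto
  then have "A ((v # xs) @ (a *\<^sub>R x + b *\<^sub>R w) # ys)
      = a *\<^sub>R A ((v # xs) @ x # ys) + b *\<^sub>R A ((v # xs) @ w # ys)"
    using assms(1) * unfolding multilin_def by blast
  then show "A (v # xs @ (a *\<^sub>R x + b *\<^sub>R w) # ys)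
      = a *\<^sub>R A (v # xs @ x # ys) + b *\<^sub>R A (v # xs @ w # ys)"
    by simp
qed

lemma multilin_Cons_combination:
  assumes "multilin d (Suc m) A" "hs \<in> lists (Rd d)" "length hs = m" "v \<in> Rd d" "w \<in> Rd d"
  shows "A ((a *\<^sub>R v + b *\<^sub>R w) # hs) = a *\<^sub>R A (v # hs) + b *\<^sub>R A (w # hs)"
proof -
  have "A ([] @ (a *\<^sub>R v + b *\<^sub>R w) # hs) = a *\<^sub>R A ([] @ v # hs) + b *\<^sub>R A ([] @ w # hs)"
    using assms unfolding multilin_def
    by (metis Suc_eq_plus1 add.commute add_0 list.size(3) lists.Nil)
  then show ?thesis by simp
qed

lemma multilin_Cons_scaleR:
  assumes "multilin d (Suc m) A" "hs \<in> lists (Rd d)" "length hs = m" "v \<in> Rd d"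
  shows "A ((a *\<^sub>R v) # hs) = a *\<^sub>R A (v # hs)"
  using multilin_Cons_combination[OF assms assms(4), of a 0] by simp

lemma multilin_Cons_sum:
  assumes "multilin d (Suc m) A" "hs \<in> lists (Rd d)" "length hs = m"
    and "\<And>j. j < (n::nat) \<Longrightarrow> v j \<in> Rd d"
  shows "A ((\<Sum>j<n. c j *\<^sub>R v j) # hs) = (\<Sum>j<n. c j *\<^sub>R A (v j # hs))"
  using assms(4)
proof (induction n)
  case 0
  then show ?case
    using multilin_Cons_scaleR[OF assms(1-3) Rd_zero, of 0] by simp
next
  case (Suc n)
  have "(\<Sum>j<n. c j *\<^sub>R v j) \<in> Rd d"
    using Suc by (intro Rd_sum Rd_scaleR) auto
  then show ?case
    using multilin_Cons_combination[OF assms(1-3), of "\<Sum>j<n. c j *\<^sub>R v j" "v n" 1 "c n"] Suc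
    by simp
qed

lemma multilin_diff:
  "multilin d m A \<Longrightarrow> multilin d m B \<Longrightarrow> multilin d m (\<lambda>hs. A hs - B hs)"
  unfolding multilin_def by (auto simp: Rd_diff algebra_simps)

text \<open>Expanding the first argument in the unit vectors leaves finitely many maps with one
  argument fewer, with coefficients of absolute value at most 1. This makes the supremum in
  \<open>opnorm\<close> finite.\<close>

lemma multilin_bounded:
  assumes "multilin d m A"
  shows "\<exists>B. \<forall>hs \<in> lists (Rd d). length hs = m \<longrightarrow> (\<forall>h\<in>set hs. norm h \<le> 1) \<longrightarrow> norm (A hs) \<le> B"
  using assms
proof (induction m arbitrary: A)
  case 0
  then show ?case by (intro exI[of _ "norm (A [])"]) auto
next
  case (Suc m)
  have "\<forall>j. \<exists>B. j < d \<longrightarrow> (\<forall>hs \<in> lists (Rd d). length hs = m \<longrightarrow> (\<forall>h\<in>set hs. norm h \<le> 1) \<longrightarrow>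
      norm (A (unit_fsv j # hs)) \<le> B)"
    using Suc.IH[OF multilin_Cons[OF Suc.prems unit_fsv_in_Rd]] by blast
  then obtain B where B: "\<And>j hs. j < d \<Longrightarrow> hs \<in> lists (Rd d) \<Longrightarrow> length hs = m \<Longrightarrow>
      (\<forall>h\<in>set hs. norm h \<le> 1) \<Longrightarrow> norm (A (unit_fsv j # hs)) \<le> B j"
    by metis
  have "norm (A hs) \<le> (\<Sum>j<d. B j)"
    if hs: "hs \<in> lists (Rd d)" "length hs = Suc m" "\<forall>h\<in>set hs. norm h \<le> 1" for hs
  proof -
    obtain h ks where [simp]: "hs = h # ks" using hs by (cases hs) auto
    have ks: "ks \<in> lists (Rd d)" "length ks = m" "\<forall>h\<in>set ks. norm h \<le> 1" "h \<in> Rd d" "norm h \<le> 1"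
      using hs by auto
    have "A hs = A ((\<Sum>j<d. coord h j *\<^sub>R unit_fsv j) # ks)"
      using Rd_expansion[OF ks(4)] by simp
    also have "\<dots> = (\<Sum>j<d. coord h j *\<^sub>R A (unit_fsv j # ks))"
      using ks by (intro multilin_Cons_sum[OF Suc.prems]) (auto simp: unit_fsv_in_Rd)
    also have "norm \<dots> \<le> (\<Sum>j<d. B j)"
    proof (rule sum_norm_le)
      fix j assume "j \<in> {..<d}"
      then have "norm (A (unit_fsv j # ks)) \<le> B j" using B ks by auto
      moreover have "\<bar>coord h j\<bar> \<le> 1" using abs_coord_le_norm[of h j] ks by linarith
      ultimately show "norm (coord h j *\<^sub>R A (unit_fsv j # ks)) \<le> B j"
        using mult_mono[of "\<bar>coord h j\<bar>" 1 "norm (A (unit_fsv j # ks))" "B j"] by auto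
    qed
    finally show ?thesis .
  qed
  then show ?case by blast
qed

lemma norm_le_opnorm:
  assumes "multilin d m A" "hs \<in> lists (Rd d)" "length hs = m" "\<forall>h\<in>set hs. norm h \<le> 1"
  shows "norm (A hs) \<le> opnorm d m A"
  unfolding opnorm_def
proof (rule cSUP_upper)
  show "hs \<in> {hs \<in> lists (Rd d). length hs = m \<and> (\<forall>h\<in>set hs. norm h \<le> 1)}"
    using assms by auto
  show "bdd_above ((\<lambda>hs. norm (A hs)) ` {hs \<in> lists (Rd d). length hs = m \<and> (\<forall>h\<in>set hs. norm h \<le> 1)})"
    using multilin_bounded[OF assms(1)] by (auto simp: bdd_above_def)
qed

lemma multilin_replicate_scaleR:
  assumes "multilin d m A" "w \<in> Rd d"
  shows "A (replicate m (r *\<^sub>R w)) = r ^ m *\<^sub>R A (replicate m w)"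
  using assms(1)
proof (induction m arbitrary: A)
  case (Suc m)
  have "replicate m (r *\<^sub>R w) \<in> lists (Rd d)"
    using assms(2) by (auto simp: Rd_scaleR)
  then show ?case
    using multilin_Cons_scaleR[OF Suc.prems, of "replicate m (r *\<^sub>R w)" w r] assms(2)
      Suc.IH[OF multilin_Cons[OF Suc.prems assms(2)]]
    by simp
qed simp

text \<open>By homogeneity it suffices to bound the value at \<open>sgn h\<close>, which lies in the
  unit ball; \<open>sgn 0 = 0\<close> covers \<open>h = 0\<close>.\<close>

lemma norm_multilin_replicate_le:
  assumes "multilin d m A" "h \<in> Rd d"
  shows "norm (A (replicate m h)) \<le> opnorm d m A * norm h ^ m"
proof -
  have w: "sgn h \<in> Rd d" "norm (sgn h) \<le> 1"
    using assms(2) by (auto simp: sgn_div_norm[of h] Rd_scaleR) (simp add: field_split_simps)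
  have "A (replicate m h) = A (replicate m (norm h *\<^sub>R sgn h))"
    by (cases "h = 0") (simp_all add: sgn_div_norm)
  also have "\<dots> = norm h ^ m *\<^sub>R A (replicate m (sgn h))"
    by (rule multilin_replicate_scaleR[OF assms(1) w(1)])
  finally have "norm (A (replicate m h)) = norm (A (replicate m (sgn h))) * norm h ^ m"
    by simp
  moreover have "norm (A (replicate m (sgn h))) \<le> opnorm d m A"
    using w by (intro norm_le_opnorm[OF assms(1)]) auto
  ultimately show ?thesis by (simp add: mult_right_mono)
qed

section \<open>Taylor's formula with a Hoelder continuous derivative\<close>

text \<open>The difference of the two sides has a nonnegative derivative on the open interval and is
  continuous up to the endpoint 0, so it increases from its value 0.\<close>

lemma comparison_powr:
  fixes G G' :: "real \<Rightarrow> real"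
  assumes "\<And>t. t \<in> {0..1} \<Longrightarrow> (G has_real_derivative G' t) (at t within {0..1})"
    and "G 0 = 0" and "\<And>t. t \<in> {0..1} \<Longrightarrow> G' t \<le> b * t powr a" and "a \<ge> 0" and "t \<in> {0..1}"
  shows "G t \<le> b * t powr (a + 1) / (a + 1)"
proof -
  let ?\<phi> = "\<lambda>s. b * s powr (a + 1) / (a + 1) - G s"
  have cont: "continuous_on {0..1} G"
    using assms(1) by (meson DERIV_continuous continuous_on_eq_continuous_within)
  have "?\<phi> 0 \<le> ?\<phi> t"
  proof (rule DERIV_nonneg_imp_increasing_open[where f = ?\<phi>])
    fix s assume s: "0 < s" "s < t"
    have "(G has_real_derivative G' s) (at s)"
      using assms(1)[of s] s assms(5) by (simp add: at_within_Icc_at)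
    moreover have "((\<lambda>s. s powr (a + 1)) has_real_derivative (a + 1) * s powr (a + 1 - 1)) (at s)"
      using s(1) by (rule has_real_derivative_powr)
    ultimately have "(?\<phi> has_real_derivative b * ((a + 1) * s powr (a + 1 - 1)) / (a + 1) - G' s) (at s)"
      by (intro DERIV_diff DERIV_cdivide DERIV_cmult)
    then have "(?\<phi> has_real_derivative (b * s powr a - G' s)) (at s)"
      using assms(4) by simp
    then show "\<exists>y. (?\<phi> has_real_derivative y) (at s) \<and> 0 \<le> y"
      using assms(3)[of s] s assms(5) by (intro exI conjI) auto
  next
    have "continuous_on {0..t} (\<lambda>s. s powr (a + 1))"
      using assms(4) by (intro continuous_on_powr' continuous_intros) auto
    moreover have "continuous_on {0..t} G"
      using assms(5) by (intro continuous_on_subset[OF cont]) auto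
    ultimately show "continuous_on {0..t} ?\<phi>"
      using assms(4)
      by (intro continuous_on_diff continuous_on_divide continuous_on_mult continuous_on_const) auto
  qed (use assms(5) in auto)
  then show ?thesis using assms(2) by simp
qed

text \<open>Induction downwards from the highest derivative: \<open>f i\<close> minus its Taylor
  polynomial has as derivative the same expression for \<open>f (Suc i)\<close>. Each integration
  raises the exponent by one and contributes a factor \<open>\<nu> + n + 1\<close> to the
  denominator; these factors form the Pochhammer symbol.\<close>

lemma taylor_comparison:
  fixes f :: "nat \<Rightarrow> real \<Rightarrow> real"
  assumes f: "\<And>i t. i < m \<Longrightarrow> t \<in> {0..1} \<Longrightarrow>
      (f i has_real_derivative f (Suc i) t) (at t within {0..1})"
    and top: "\<And>t. t \<in> {0..1} \<Longrightarrow> f m t - f m 0 \<le> B * t powr \<nu>" and "\<nu> \<ge> 0"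
    and "i + n = m" and "t \<in> {0..1}"
  shows "f i t - (\<Sum>j\<le>n. f (i + j) 0 * t ^ j / fact j) \<le> B * t powr (\<nu> + n) / pochhammer (\<nu> + 1) n"
  using assms(4,5)
proof (induction n arbitrary: i t)
  case 0
  then show ?case using top[of t] by simp
next
  case (Suc n)
  let ?G = "\<lambda>t. f i t - (\<Sum>j\<le>Suc n. f (i + j) 0 * t ^ j / fact j)"
  let ?G' = "\<lambda>t. f (Suc i) t - (\<Sum>j\<le>n. f (Suc i + j) 0 * t ^ j / fact j)"
  have "?G t \<le> B / pochhammer (\<nu> + 1) n * t powr (\<nu> + n + 1) / (\<nu> + n + 1)"
  proof (rule comparison_powr)
    fix s :: real assume s: "s \<in> {0..1}"
    \<comment> \<open>Splitting off the constant term shifts the index, so that termwise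
      differentiation yields \<open>?G'\<close>.\<close>
    have G: "?G = (\<lambda>t. f i t - (f i 0 + (\<Sum>j\<le>n. f (Suc i + j) 0 * t ^ Suc j / fact (Suc j))))"
      by (subst sum.atMost_Suc_shift) simp
    have "((\<lambda>t. f (Suc i + j) 0 * t ^ Suc j / fact (Suc j)) has_real_derivative
        f (Suc i + j) 0 * s ^ j / fact j) (at s within {0..1})" for j
    proof -
      have "((\<lambda>t. f (Suc i + j) 0 * t ^ Suc j / fact (Suc j)) has_real_derivative
          f (Suc i + j) 0 * (real (Suc j) * s ^ j) / fact (Suc j)) (at s within {0..1})"
        by (rule derivative_eq_intros refl | simp)+
      moreover have "f (Suc i + j) 0 * (real (Suc j) * s ^ j) / fact (Suc j)
          = f (Suc i + j) 0 * s ^ j / fact j"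
        by (simp add: divide_simps)
      ultimately show ?thesis by simp
    qed
    then have "((\<lambda>t. \<Sum>j\<le>n. f (Suc i + j) 0 * t ^ Suc j / fact (Suc j)) has_real_derivative
        (\<Sum>j\<le>n. f (Suc i + j) 0 * s ^ j / fact j)) (at s within {0..1})"
      by (rule DERIV_sum)
    then show "(?G has_real_derivative ?G' s) (at s within {0..1})"
      unfolding G using f[of i s] s Suc.prems
      by (intro DERIV_diff DERIV_add[OF DERIV_const, THEN DERIV_cong]) auto
    show "?G' s \<le> B / pochhammer (\<nu> + 1) n * s powr (\<nu> + n)"
      using Suc.IH[of "Suc i" s] s Suc.prems by simp
  next
    show "?G 0 = 0"
      by (subst sum.atMost_Suc_shift) simp
  qed (use assms(3) Suc.prems in auto)
  also have "\<dots> = B * t powr (\<nu> + Suc n) / pochhammer (\<nu> + 1) (Suc n)"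
    by (simp add: pochhammer_Suc algebra_simps)
  finally show ?case .
qed

text \<open>The integral is a Beta function, and the quotient of Gamma values collapses to the
  Pochhammer symbol that \<open>taylor_comparison\<close> produces.\<close>

lemma C_const_eq:
  assumes "p \<ge> 2" "\<nu> \<ge> 0"
  shows "C_const p \<nu> = 1 / pochhammer (\<nu> + 1) (p - 1)"
proof -
  have I: "((\<lambda>t. t powr (\<nu> + 1 - 1) * (1 - t) powr (real (p - 1) - 1)) has_integral
      Beta (\<nu> + 1) (real (p - 1))) {0..1}"
    using assms by (intro has_integral_Beta_real) auto
  have eq: "(1 - t) ^ (p - 2) * t powr \<nu> = t powr (\<nu> + 1 - 1) * (1 - t) powr (real (p - 1) - 1)"
    if "t \<in> {0..1} - {1}" for t :: real
  proof -
    have "real (p - 1) - 1 = real (p - 2)" using assms by (simp add: of_nat_diff)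
    moreover have "(1 - t) powr real (p - 2) = (1 - t) ^ (p - 2)"
      using that by (intro powr_realpow) auto
    ultimately show ?thesis by simp
  qed
  \<comment> \<open>The point 1 is excepted: for \<open>p = 2\<close> the integrands differ there,
    since \<open>0 ^ 0 = 1\<close> but \<open>0 powr 0 = 0\<close>.\<close>
  have "((\<lambda>t. (1 - t) ^ (p - 2) * t powr \<nu>) has_integral
      Beta (\<nu> + 1) (real (p - 1))) {0..1}"
    by (rule has_integral_spike_finite[where S = "{1}", OF _ eq I]) simp
  then have "integral {0..1} (\<lambda>t. (1 - t) ^ (p - 2) * t powr \<nu>) = Beta (\<nu> + 1) (real (p - 1))"
    by (rule integral_unique)
  also have "\<dots> = fact (p - 2) / pochhammer (\<nu> + 1) (p - 1)"
  proof -
    have "\<nu> + 1 \<notin> \<int>\<^sub>\<le>\<^sub>0" using assms(2) by auto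
    then have "pochhammer (\<nu> + 1) (p - 1) = Gamma (\<nu> + 1 + (p - 1)) / Gamma (\<nu> + 1)"
      by (rule pochhammer_Gamma)
    moreover have "Gamma (real (p - 1)) = fact (p - 2)"
      using Gamma_fact[of "p - 2", where 'a = real] assms(1) by (simp add: of_nat_diff algebra_simps)
    ultimately show ?thesis by (simp add: Beta_def)
  qed
  finally show ?thesis by (simp add: C_const_def)
qed

lemma C_const_pos: "C_const p \<nu> > 0" if "p \<ge> 2" "\<nu> \<ge> 0"
  using that by (simp add: C_const_eq pochhammer_pos)

text \<open>Pairing the derivatives along the segment from \<open>z\<close> to \<open>u\<close> with
  the remainder \<open>?R\<close> itself gives real functions to which
  \<open>taylor_comparison\<close> applies. The result bounds the square of \<open>norm ?R\<close>
  by the desired constant times \<open>norm ?R\<close>, and one factor cancels.\<close>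

lemma taylor_remainder:
  assumes p: "p \<ge> 2" and \<nu>: "0 \<le> \<nu>" "\<nu> \<le> 1" and Z: "convex Z" "Z \<subseteq> Rd d"
    and DF: "derivs d Z F (p - 1) DF"
    and H: "holder_constants d Z p DF Hc" "Hc \<nu> < \<infinity>"
    and z: "z \<in> Z" and u: "u \<in> Z"
  shows "norm (F u - taylor_model p DF z u)
    \<le> C_const p \<nu> * enn2real (Hc \<nu>) * norm (u - z) powr (real p - 1 + \<nu>)"
proof -
  let ?m = "p - 1" and ?h = "u - z" and ?L = "enn2real (Hc \<nu>)"
  let ?x = "\<lambda>t. z + t *\<^sub>R ?h"
  let ?R = "F u - taylor_model p DF z u"
  define f where "f = (\<lambda>i t. inner (DF i (?x t) (replicate i ?h)) ?R)"
  define B where "B = ?L * norm ?h powr (real p - 1 + \<nu>) * norm ?R"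
  have h: "?h \<in> Rd d" using z u Z by (auto intro: Rd_diff)
  have x: "?x t \<in> Z" if "t \<in> {0..1}" for t
  proof -
    have "?x t = (1 - t) *\<^sub>R z + t *\<^sub>R u" by (simp add: algebra_simps)
    then show ?thesis using that convexD_alt[OF Z(1) z u, of t] by simp
  qed
  have ml: "multilin d i (DF i w)" if "i \<le> ?m" "w \<in> Z" for i w
    using DF that unfolding derivs_def by auto
  have opnorm: "opnorm d ?m (\<lambda>hs. DF ?m w hs - DF ?m v hs) \<le> ?L * norm (w - v) powr \<nu>"
    if "w \<in> Z" "v \<in> Z" for w v
  proof -
    have "ennreal (opnorm d ?m (\<lambda>hs. DF ?m w hs - DF ?m v hs)) \<le> Hc \<nu> * ennreal (norm (w - v) powr \<nu>)"
      using H(1) \<nu> that unfolding holder_constants_def by auto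
    also have "Hc \<nu> = ennreal ?L" using H(2) by simp
    also have "ennreal ?L * ennreal (norm (w - v) powr \<nu>) = ennreal (?L * norm (w - v) powr \<nu>)"
      by (simp add: ennreal_mult)
    finally show ?thesis by (simp add: ennreal_le_iff)
  qed
  have "f 0 1 - (\<Sum>j\<le>?m. f (0 + j) 0 * 1 ^ j / fact j)
      \<le> B * 1 powr (\<nu> + ?m) / pochhammer (\<nu> + 1) ?m"
  proof (rule taylor_comparison[where m = ?m])
    fix i t assume i: "i < ?m" and t: "t \<in> {0..1::real}"
    have rep: "replicate i ?h \<in> lists (Rd d)" using h by auto
    have "((\<lambda>x. DF i x (replicate i ?h)) has_derivative
        (\<lambda>h. DF (Suc i) (?x t) (proj d h # replicate i ?h))) (at (?x t) within Z)"
      using DF i x[OF t] rep unfolding derivs_def by auto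
    \<comment> \<open>The chain rule needs the derivative within the image of the parameter
      interval, which lies in \<open>Z\<close> by convexity.\<close>
    then have D: "((\<lambda>x. DF i x (replicate i ?h)) has_derivative
        (\<lambda>h. DF (Suc i) (?x t) (proj d h # replicate i ?h))) (at (?x t) within ?x ` {0..1})"
      by (rule has_derivative_subset) (use x in blast)
    have "((\<lambda>t. ?x t) has_derivative (\<lambda>s. s *\<^sub>R ?h)) (at t within {0..1})"
      by (auto intro!: derivative_eq_intros)
    from has_derivative_in_compose[OF this D]
    have "((\<lambda>t. DF i (?x t) (replicate i ?h)) has_derivative
        (\<lambda>s. DF (Suc i) (?x t) (proj d (s *\<^sub>R ?h) # replicate i ?h))) (at t within {0..1})" .
    moreover have "DF (Suc i) (?x t) (proj d (s *\<^sub>R ?h) # replicate i ?h)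
        = s *\<^sub>R DF (Suc i) (?x t) (replicate (Suc i) ?h)" for s
      using multilin_Cons_scaleR[OF ml[OF _ x[OF t]], of i "replicate i ?h" ?h s] i rep h
      by (simp add: proj_Rd Rd_scaleR)
    ultimately have "((\<lambda>t. DF i (?x t) (replicate i ?h)) has_derivative
        (\<lambda>s. s *\<^sub>R DF (Suc i) (?x t) (replicate (Suc i) ?h))) (at t within {0..1})"
      by simp
    then have "((\<lambda>t. DF i (?x t) (replicate i ?h)) has_vector_derivative
        DF (Suc i) (?x t) (replicate (Suc i) ?h)) (at t within {0..1})"
      by (simp only: has_vector_derivative_def)
    then have "((\<lambda>t. inner (DF i (?x t) (replicate i ?h)) ?R) has_vector_derivative
        inner (DF (Suc i) (?x t) (replicate (Suc i) ?h)) ?R) (at t within {0..1})"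
      by (rule bounded_linear.has_vector_derivative[OF bounded_linear_inner_left])
    then show "(f i has_real_derivative f (Suc i) t) (at t within {0..1})"
      unfolding f_def by (simp only: has_real_derivative_iff_has_vector_derivative)
  next
    fix t :: real assume t: "t \<in> {0..1}"
    let ?A = "\<lambda>hs. DF ?m (?x t) hs - DF ?m (?x 0) hs"
    have z0: "?x 0 = z" by simp
    have mlA: "multilin d ?m ?A"
      using x[OF t] x[of 0] by (intro multilin_diff ml) auto
    have "f ?m t - f ?m 0 = inner (?A (replicate ?m ?h)) ?R"
      by (simp add: f_def inner_diff_left)
    also have "\<dots> \<le> norm (?A (replicate ?m ?h)) * norm ?R"
      by (rule norm_cauchy_schwarz)
    also have "norm (?A (replicate ?m ?h)) \<le> opnorm d ?m ?A * norm ?h ^ ?m"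
      by (rule norm_multilin_replicate_le[OF mlA h])
    also have "opnorm d ?m ?A \<le> ?L * norm (?x t - ?x 0) powr \<nu>"
      using x[OF t] x[of 0] by (intro opnorm) auto
    also have "norm (?x t - ?x 0) = t * norm ?h" using t by simp
    also have "?L * (t * norm ?h) powr \<nu> * norm ?h ^ ?m * norm ?R = B * t powr \<nu>"
    proof (cases "?h = 0")
      case True
      then show ?thesis using p \<nu> by (simp add: B_def)
    next
      case False
      then have "norm ?h powr (real p - 1 + \<nu>) = norm ?h ^ ?m * norm ?h powr \<nu>"
        using p by (simp add: powr_add powr_realpow[symmetric] of_nat_diff)
      then show ?thesis using t by (simp add: B_def powr_mult)
    qed
    finally show "f ?m t - f ?m 0 \<le> B * t powr \<nu>"
      by (simp add: mult_right_mono)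
  qed (use \<nu> in auto)
  moreover have "f 0 1 = inner (F u) ?R"
    using DF u unfolding f_def derivs_def by simp
  moreover have "(\<Sum>j\<le>?m. f (0 + j) 0 * 1 ^ j / fact j) = inner (taylor_model p DF z u) ?R"
  proof -
    have "{..?m} = {..<p}" using p by auto
    then show ?thesis unfolding f_def taylor_model_def inner_sum_left by simp
  qed
  ultimately have "inner ?R ?R \<le> B / pochhammer (\<nu> + 1) ?m"
    by (simp add: inner_diff_left)
  then have "norm ?R * norm ?R
      \<le> C_const p \<nu> * ?L * norm ?h powr (real p - 1 + \<nu>) * norm ?R"
    using p \<nu> by (simp add: B_def C_const_eq dot_square_norm power2_eq_square)
  moreover have "0 \<le> C_const p \<nu> * ?L * norm ?h powr (real p - 1 + \<nu>)"
    using C_const_pos[OF p \<nu>(1)] by simp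
  ultimately show ?thesis
    by (cases "?R = 0") (auto simp del: right_minus_eq)
qed

section \<open>Auxiliary inequalities\<close>

text \<open>Turns the inner products of optimality conditions into squared distances, which cancel
  or telescope.\<close>

lemma inner_three_point:
  "inner (a - b) (c - a) = ((norm (b - c))\<^sup>2 - (norm (a - c))\<^sup>2 - (norm (a - b))\<^sup>2) / 2"
  by (simp add: power2_norm_eq_inner inner_diff_left inner_diff_right inner_commute)

lemma power2_powr_half:
  fixes x :: real
  assumes "x > 0" "p \<ge> 1"
  shows "(x\<^sup>2) powr ((real p - 1) / 2) = x ^ (p - 1)"
proof -
  have "(x\<^sup>2) powr ((real p - 1) / 2) = (x powr 2) powr ((real p - 1) / 2)"
    using assms(1) by simp
  also have "\<dots> = x powr real (p - 1)"
    using assms(2) by (simp add: powr_powr of_nat_diff diff_divide_distrib del: powr_numeral)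
  also have "\<dots> = x ^ (p - 1)"
    using assms(1) by (rule powr_realpow)
  finally show ?thesis .
qed

text \<open>With \<open>c = B / K\<close>, the convex function \<open>y powr (- a)\<close> lies
  above its tangent at 1, that is, above \<open>1 - a * (y - 1)\<close>. This is summed over
  \<open>y = x k / c\<close>; the linear terms add up to something nonnegative because the mean of
  the \<open>x k\<close> is at most \<open>c\<close>.\<close>

lemma power_mean_inverse:
  fixes x :: "nat \<Rightarrow> real"
  assumes x: "\<And>k. k < K \<Longrightarrow> x k > 0" and B: "(\<Sum>k<K. x k) \<le> B" and "B > 0" "K \<ge> 1" "a \<ge> 0"
  shows "real K * (B / real K) powr (- a) \<le> (\<Sum>k<K. x k powr (- a))"
proof -
  define c where "c = B / real K"
  have c: "c > 0" using assms by (simp add: c_def)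
  have "real K * c powr (- a) \<le> c powr (- a) * (real K - a * ((\<Sum>k<K. x k) / c - real K))"
  proof -
    have "(\<Sum>k<K. x k) / c \<le> real K"
      using B c assms(4) by (simp add: c_def field_simps)
    then have "a * ((\<Sum>k<K. x k) / c - real K) \<le> 0"
      using assms(5) by (simp add: mult_nonneg_nonpos)
    then show ?thesis using c by (simp add: mult.commute mult_left_mono)
  qed
  also have "\<dots> = (\<Sum>k<K. c powr (- a) * (1 - a * (x k / c - 1)))"
    by (simp add: sum_distrib_left[symmetric] sum_subtractf sum_divide_distrib)
  also have "\<dots> \<le> (\<Sum>k<K. x k powr (- a))"
  proof (rule sum_mono)
    fix k assume "k \<in> {..<K}"
    then have xk: "x k / c > 0" using x c by simp
    have "1 - a * (x k / c - 1) \<le> 1 + (- a) * ln (x k / c)"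
      using mult_left_mono[OF ln_le_minus_one[OF xk] assms(5)] by simp
    also have "\<dots> \<le> (x k / c) powr (- a)"
      using exp_ge_add_one_self[of "(- a) * ln (x k / c)"] xk unfolding powr_def by auto
    finally have "c powr (- a) * (1 - a * (x k / c - 1)) \<le> c powr (- a) * (x k / c) powr (- a)"
      by (intro mult_left_mono) auto
    also have "\<dots> = x k powr (- a)"
      using c xk by (simp add: powr_mult[symmetric])
    finally show "c powr (- a) * (1 - a * (x k / c - 1)) \<le> x k powr (- a)" .
  qed
  finally show ?thesis by (simp add: c_def)
qed

text \<open>For small accuracies the main term of the complexity bound absorbs both the logarithmic
  overhead of the line searches and the rounding of the number of iterations.\<close>

lemma log_le_powr_near_0:
  fixes A B s :: real
  assumes "A > 0" "B > 0" "s > 0"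
  shows "\<exists>\<epsilon>0>0. \<forall>\<epsilon>. 0 < \<epsilon> \<and> \<epsilon> < \<epsilon>0 \<longrightarrow>
    1 \<le> B * \<epsilon> powr (- s) \<and> log 2 (A / \<epsilon>) \<le> B * \<epsilon> powr (- s) \<and> \<epsilon> \<le> 1"
proof -
  have "eventually (\<lambda>\<epsilon>. log 2 (A / \<epsilon>) \<le> B * \<epsilon> powr (- s)) (at_right 0)"
    using assms by real_asymp
  moreover have "eventually (\<lambda>\<epsilon>. 1 \<le> B * \<epsilon> powr (- s)) (at_right 0)"
    using assms by real_asymp
  moreover have "eventually (\<lambda>\<epsilon>. \<epsilon> \<le> (1::real)) (at_right 0)"
    by real_asymp
  ultimately have "eventually (\<lambda>\<epsilon>. 1 \<le> B * \<epsilon> powr (- s) \<and> log 2 (A / \<epsilon>) \<le> B * \<epsilon> powr (- s) \<and> \<epsilon> \<le> 1)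
      (at_right 0)"
    by eventually_elim simp
  then show ?thesis
    unfolding eventually_at_right_field by auto
qed

text \<open>Compactness provides a minimizer, so \<open>arg_min_on\<close> returns one. The
  first-order condition follows by moving from \<open>x\<close> towards \<open>u\<close> and letting
  the step tend to 0.\<close>

lemma prox_optimality:
  fixes Z :: "'a :: real_inner set" and g z :: 'a and \<gamma> :: real
  assumes "compact Z" "convex Z" "Z \<noteq> {}"
  defines "x \<equiv> arg_min_on (\<lambda>x. inner g (x - z) + \<gamma> / 2 * (norm (x - z))\<^sup>2) Z"
  shows "x \<in> Z" and "\<And>u. u \<in> Z \<Longrightarrow> inner (g + \<gamma> *\<^sub>R (x - z)) (u - x) \<ge> 0"
proof -
  let ?\<phi> = "\<lambda>x. inner g (x - z) + \<gamma> / 2 * (norm (x - z))\<^sup>2"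
  have "continuous_on Z ?\<phi>" by (intro continuous_intros)
  then obtain w where w: "w \<in> Z" "\<And>y. y \<in> Z \<Longrightarrow> ?\<phi> w \<le> ?\<phi> y"
    using continuous_attains_inf[OF assms(1,3)] by blast
  have "is_arg_min ?\<phi> (\<lambda>x. x \<in> Z) x"
    unfolding x_def arg_min_on_def arg_min_def
    by (rule someI[of _ w]) (use w in \<open>auto simp: is_arg_min_linorder\<close>)
  then have x: "x \<in> Z" and min: "\<And>y. y \<in> Z \<Longrightarrow> ?\<phi> x \<le> ?\<phi> y"
    by (auto simp: is_arg_min_linorder)
  show "x \<in> Z" by (rule x)
  fix u assume u: "u \<in> Z"
  define a where "a = inner (g + \<gamma> *\<^sub>R (x - z)) (u - x)"
  define b where "b = \<gamma> / 2 * (norm (u - x))\<^sup>2"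
  have ab: "a + t * b \<ge> 0" if t: "0 < t" "t \<le> 1" for t
  proof -
    have "x + t *\<^sub>R (u - x) = (1 - t) *\<^sub>R x + t *\<^sub>R u" by (simp add: algebra_simps)
    then have "x + t *\<^sub>R (u - x) \<in> Z"
      using convexD_alt[OF assms(2) x u, of t] t by simp
    \<comment> \<open>The objective is quadratic, so its increment along the segment is exactly
      \<open>t * (a + t * b)\<close>.\<close>
    from min[OF this] have "0 \<le> t * (a + t * b)"
      unfolding a_def b_def power2_norm_eq_inner
      by (simp add: inner_add_left inner_add_right inner_diff_left inner_diff_right
          inner_commute algebra_simps)
    then show ?thesis using t by (simp add: zero_le_mult_iff)
  qed
  have "((\<lambda>t. a + t * b) \<longlongrightarrow> a + 0 * b) (at_right 0)"
    by (intro tendsto_intros)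
  moreover have "eventually (\<lambda>t. a + t * b \<ge> 0) (at_right 0)"
    unfolding eventually_at_right_field using ab by (intro exI[of _ 1]) auto
  ultimately show "a \<ge> 0"
    using tendsto_lowerbound[of "\<lambda>t. a + t * b" "a + 0 * b" "at_right 0" 0] by simp
qed

section \<open>The constant of the line search\<close>

context
  fixes p :: nat and \<nu> D :: real and Hc :: "real \<Rightarrow> ennreal"
  assumes p: "p \<ge> 2" and \<nu>: "0 \<le> \<nu>" "\<nu> \<le> 1" and D: "D > 0" and Hc: "Hc \<nu> < \<infinity>"
begin

lemma admissible_le: "admissible p D Hc \<epsilon> H0 \<Longrightarrow> ennreal H0 \<le> M_const p D Hc \<epsilon> \<nu>"
  using \<nu> INF_lower[of \<nu> "{0..1}" "M_const p D Hc \<epsilon>"] order_trans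
  by (auto simp: admissible_def)

text \<open>If the Hoelder constant were 0, \<open>M_const\<close> would be 0 as well and would
  leave no room for a positive \<open>H0\<close>.\<close>

lemma admissible_holder_pos:
  assumes "admissible p D Hc \<epsilon> H0"
  shows "enn2real (Hc \<nu>) > 0"
proof (rule ccontr)
  assume "\<not> ?thesis"
  then have "enn2real (Hc \<nu>) = 0" using enn2real_nonneg[of "Hc \<nu>"] by linarith
  then have "M_const p D Hc \<epsilon> \<nu> = 0"
    using Hc by (simp add: M_const_def)
  then show False
    using admissible_le[OF assms] assms by (simp add: admissible_def)
qed

text \<open>The base of the power is positive, so \<open>powr\<close> itself gives 1 at exponent 0
  and the case distinction in \<open>M_const\<close> disappears.\<close>

lemma M_const_eq:
  assumes "enn2real (Hc \<nu>) > 0" "\<epsilon> > 0"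
  shows "enn2real (M_const p D Hc \<epsilon> \<nu>) = 2 * (C_const p \<nu> * enn2real (Hc \<nu>)) *
    (3 * D * (C_const p \<nu> * enn2real (Hc \<nu>)) / \<epsilon>) powr ((1 - \<nu>) / (real p - 1 + \<nu>))"
  using assms Hc D C_const_pos[OF p \<nu>(1)] by (auto simp: M_const_def Let_def)

text \<open>The exponent of the Hoelder constant is
  \<open>1 + (1 - \<nu>) / (p - 1 + \<nu>)\<close>, which simplifies to
  \<open>p / (p - 1 + \<nu>)\<close>.\<close>

lemma M_const_explicit:
  assumes "enn2real (Hc \<nu>) > 0" "\<epsilon> > 0"
  shows "enn2real (M_const p D Hc \<epsilon> \<nu>) =
    2 * C_const p \<nu> * (3 * C_const p \<nu>) powr ((1 - \<nu>) / (real p - 1 + \<nu>))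
    * enn2real (Hc \<nu>) powr (real p / (real p - 1 + \<nu>))
    * D powr ((1 - \<nu>) / (real p - 1 + \<nu>)) / \<epsilon> powr ((1 - \<nu>) / (real p - 1 + \<nu>))"
proof -
  let ?e = "(1 - \<nu>) / (real p - 1 + \<nu>)" and ?L = "enn2real (Hc \<nu>)" and ?C = "C_const p \<nu>"
  have C: "?C > 0" by (rule C_const_pos[OF p \<nu>(1)])
  have "(3 * D * (?C * ?L) / \<epsilon>) powr ?e = ((3 * ?C) * D * ?L / \<epsilon>) powr ?e"
    by (simp add: ac_simps)
  also have "\<dots> = (3 * ?C) powr ?e * D powr ?e * ?L powr ?e / \<epsilon> powr ?e"
    using C assms D by (simp add: powr_mult powr_divide)
  finally have "(3 * D * (?C * ?L) / \<epsilon>) powr ?e = \<dots>" .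
  moreover have "real p / (real p - 1 + \<nu>) = 1 + ?e"
    using p \<nu> by (simp add: field_simps)
  then have "?L powr (real p / (real p - 1 + \<nu>)) = ?L * ?L powr ?e"
    using assms(1) by (simp add: powr_add)
  ultimately show ?thesis
    using M_const_eq[OF assms] by (simp add: ac_simps)
qed

lemma admissible_le_real:
  assumes "admissible p D Hc \<epsilon> H0"
  shows "H0 \<le> enn2real (M_const p D Hc \<epsilon> \<nu>)"
proof -
  have "M_const p D Hc \<epsilon> \<nu> < \<infinity>"
    using Hc by (auto simp: M_const_def Let_def)
  then have "enn2real (ennreal H0) \<le> enn2real (M_const p D Hc \<epsilon> \<nu>)"
    using admissible_le[OF assms] by (intro enn2real_mono) auto
  then show ?thesis using assms by (simp add: admissible_def)
qed

end

section \<open>Analysis of the universal tensor extragradient method\<close>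

locale uteg_run = uteg Z p F DF T z0 H0
  for Z :: "fsv set" and p :: nat and F :: "fsv \<Rightarrow> fsv"
    and DF :: "nat \<Rightarrow> fsv \<Rightarrow> fsv list \<Rightarrow> fsv"
    and T :: "fsv \<Rightarrow> real \<Rightarrow> fsv" and z0 :: fsv and H0 :: real +
  fixes d :: nat and \<nu> D \<epsilon> :: real and Hc :: "real \<Rightarrow> ennreal"
  assumes p: "p \<ge> 2" and \<nu>: "0 \<le> \<nu>" "\<nu> \<le> 1"
    and Z: "Z \<noteq> {}" "closed Z" "convex Z" "Z \<subseteq> Rd d"
    and DF: "derivs d Z F (p - 1) DF"
    and mono: "\<And>z u. z \<in> Z \<Longrightarrow> u \<in> Z \<Longrightarrow> inner (F z - F u) (z - u) \<ge> 0"
    and D: "D > 0" "\<And>z u. z \<in> Z \<Longrightarrow> u \<in> Z \<Longrightarrow> norm (z - u) \<le> D"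
    and holder: "holder_constants d Z p DF Hc" "Hc \<nu> < \<infinity>"
    and z0: "z0 \<in> Z"
    and \<epsilon>: "\<epsilon> > 0" and admissible: "admissible p D Hc \<epsilon> H0"
    and solver: "model_solver Z p DF T"
begin

abbreviation "L \<equiv> enn2real (Hc \<nu>)"
abbreviation "C \<equiv> C_const p \<nu>"
abbreviation "M\<nu> \<equiv> enn2real (M_const p D Hc \<epsilon> \<nu>)"
abbreviation "rk k \<equiv> norm (zhalf k - zk k)"

lemma C_pos: "C > 0" and L_pos: "L > 0" and H0_pos: "H0 > 0" and H0_le: "H0 \<le> M\<nu>"
  using C_const_pos[OF p \<nu>(1)] admissible_holder_pos[where \<nu> = \<nu> and Hc = Hc, OF p \<nu> D(1) holder(2) admissible]
    admissible admissible_le_real[where \<nu> = \<nu> and Hc = Hc, OF p \<nu> D(1) holder(2) admissible]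
  by (auto simp: admissible_def)

lemma M\<nu>_pos: "M\<nu> > 0"
  using H0_pos H0_le by linarith

lemma compact_Z: "compact Z"
proof (rule compact_in_Rd[OF Z(2,4)])
  have "norm x \<le> norm z0 + D" if "x \<in> Z" for x
    using D(2)[OF that z0] norm_triangle_sub[of x z0] by linarith
  then show "bounded Z" by (auto simp: bounded_iff)
qed

lemma zk_Suc: "zk (Suc k) = arg_min_on
    (\<lambda>x. inner (F (zhalf k)) (x - zk k) + \<gamma>k k / 2 * (norm (x - zk k))\<^sup>2) Z"
  and Hk_Suc: "Hk (Suc k) = Mk k / 2"
  by (simp_all add: zk_def Hk_def zhalf_def trial_def \<gamma>k_def Mk_def ik_def Let_def)

text \<open>This holds even beyond a line search that does not terminate: whatever number
  \<open>search\<close> returns there, the update still minimizes over \<open>Z\<close>.\<close>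

lemma zk_in: "zk k \<in> Z"
proof (cases k)
  case 0
  then show ?thesis using z0 by (simp add: zk_def)
next
  case (Suc j)
  then show ?thesis
    using prox_optimality(1)[OF compact_Z Z(3,1)] by (simp add: zk_Suc)
qed

lemma Hk_pos: "Hk k > 0"
proof (induction k)
  case 0
  then show ?case using H0_pos by (simp add: Hk_def)
qed (simp add: Hk_Suc Mk_def)

lemma Mk_pos: "Mk k > 0"
  using Hk_pos by (simp add: Mk_def)

lemma T_in: "z \<in> Z \<Longrightarrow> M > 0 \<Longrightarrow> T z M \<in> Z"
  and T_VI: "z \<in> Z \<Longrightarrow> M > 0 \<Longrightarrow> u \<in> Z \<Longrightarrow> inner (reg_model p DF M z (T z M)) (u - T z M) \<ge> 0"
  using solver by (auto simp: model_solver_def VI_def)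

lemma trial_in: "trial k i \<in> Z"
  unfolding trial_def using Hk_pos by (intro T_in zk_in) auto

lemma zhalf_in: "zhalf k \<in> Z"
  by (simp add: zhalf_def trial_in)

section \<open>Gaps of trial points and the constants of rejected ones\<close>

lemma accepts_iff: "accepts z H i \<longleftrightarrow>
    norm (F (T z (H * 2 ^ i)) - taylor_model p DF z (T z (H * 2 ^ i)))
      \<le> H * 2 ^ i / 2 * norm (T z (H * 2 ^ i) - z) ^ p"
  by (simp add: accepts_def Let_def power_int_diff)

text \<open>Split the operator at the trial point \<open>y\<close> into model and error. The
  variational inequality tested at \<open>u\<close> bounds the model part by the regularization
  term; Cauchy-Schwarz and the diameter bound the rest.\<close>

lemma strong_gap_T_le:
  assumes z: "z \<in> Z" and M: "M > 0"
  shows "strong_gap Z F (T z M)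
    \<le> D * (norm (F (T z M) - taylor_model p DF z (T z M)) + M * norm (T z M - z) ^ p)"
  unfolding strong_gap_def
proof (rule cSUP_least[OF Z(1)])
  fix u assume u: "u \<in> Z"
  define y r t where "y = T z M" and "r = norm (y - z)" and "t = taylor_model p DF z y"
  have yD: "norm (y - u) \<le> D" unfolding y_def by (intro D(2) T_in z M u)
  have "0 \<le> inner (t + (M * r ^ (p - 1)) *\<^sub>R (y - z)) (u - y)"
    using T_VI[OF z M u] by (simp add: reg_model_def t_def y_def r_def)
  also have "\<dots> = M * r ^ (p - 1) * inner (y - z) (u - y) - inner t (y - u)"
    by (simp add: inner_add_left inner_diff_right right_diff_distrib)
  finally have "inner t (y - u) \<le> M * r ^ (p - 1) * inner (y - z) (u - y)" by simp
  also have "\<dots> \<le> M * r ^ (p - 1) * (r * D)"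
  proof (rule mult_left_mono)
    have "inner (y - z) (u - y) \<le> norm (y - z) * norm (u - y)" by (rule norm_cauchy_schwarz)
    also have "\<dots> \<le> r * D" using yD by (simp add: r_def y_def norm_minus_commute mult_left_mono)
    finally show "inner (y - z) (u - y) \<le> r * D" .
  qed (use M in \<open>simp add: r_def\<close>)
  also have "\<dots> = D * (M * r ^ p)"
    using p by (simp add: power_eq_if)
  finally have "inner t (y - u) \<le> D * (M * r ^ p)" .
  moreover have "inner (F y - t) (y - u) \<le> norm (F y - t) * D"
    using norm_cauchy_schwarz[of "F y - t" "y - u"] mult_left_mono[OF yD norm_ge_zero[of "F y - t"]]
    by linarith
  ultimately show "inner (F (T z M)) (T z M - u)
      \<le> D * (norm (F (T z M) - taylor_model p DF z (T z M)) + M * norm (T z M - z) ^ p)"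
    by (simp add: y_def[symmetric] t_def[symmetric] r_def[symmetric] inner_diff_left algebra_simps)
qed

text \<open>Rejection together with Taylor's bound gives
  \<open>M < 2 * C * L * r powr (- (1 - \<nu>))\<close>, where \<open>r\<close> is the step length,
  while the large gap bounds \<open>r\<close> from below. Eliminating \<open>r\<close> leaves the
  constant \<open>M\<nu>\<close>.\<close>

lemma rejected_less:
  assumes z: "z \<in> Z" and M: "M > 0" and gap: "\<epsilon> \<le> strong_gap Z F (T z M)"
    and rej: "norm (F (T z M) - taylor_model p DF z (T z M)) > M / 2 * norm (T z M - z) ^ p"
  shows "M < M\<nu>"
proof -
  define r n where "r = norm (T z M - z)" and "n = norm (F (T z M) - taylor_model p DF z (T z M))"
  let ?q = "real p - 1 + \<nu>"
  let ?e = "(1 - \<nu>) / ?q"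
  define s where "s = r powr ?q"
  have q: "?q > 0" using p \<nu> by simp
  have n: "n \<le> C * L * s"
    unfolding n_def s_def r_def
    by (rule taylor_remainder[OF p \<nu> Z(3,4) DF holder z T_in[OF z M]])
  have rej': "M / 2 * r ^ p < n" using rej by (simp add: r_def n_def)
  \<comment> \<open>A zero step has zero model error by Taylor's bound and would have been
    accepted.\<close>
  have "r > 0"
  proof (rule ccontr)
    assume "\<not> r > 0"
    then have "r = 0" by (simp add: r_def)
    then show False using rej' n p q by (simp add: s_def power_0_left)
  qed
  then have s: "s > 0" by (simp add: s_def)
  have "\<epsilon> \<le> D * (n + M * r ^ p)"
    using gap strong_gap_T_le[OF z M] by (simp add: r_def n_def)
  \<comment> \<open>Rejection means \<open>M * r ^ p < 2 * n\<close>, so the sum is below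
    \<open>3 * n\<close>: this is the factor 3 in \<open>M_const\<close>.\<close>
  also have "\<dots> < D * (3 * (C * L * s))"
    using rej' n D(1) by (intro mult_strict_left_mono) auto
  finally have "1 / s < 3 * D * (C * L) / \<epsilon>"
    using s \<epsilon> by (simp add: field_simps)
  then have "(1 / s) powr ?e \<le> (3 * D * (C * L) / \<epsilon>) powr ?e"
    using s \<nu> q by (intro powr_mono2) auto
  moreover have "M < 2 * (C * L) * (1 / s) powr ?e"
  proof -
    \<comment> \<open>The power of \<open>r\<close> is rewritten as a power of \<open>s\<close>, the
      quantity that the gap bounds from below.\<close>
    have "s / r ^ p = r powr (- (1 - \<nu>))"
      using \<open>r > 0\<close> by (simp add: s_def powr_realpow[symmetric] powr_diff[symmetric])
    also have "- (1 - \<nu>) = ?q * - ?e" using q by simp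
    also have "r powr (?q * - ?e) = s powr (- ?e)"
      unfolding s_def by (rule powr_powr[symmetric])
    also have "\<dots> = (1 / s) powr ?e"
      using s by (simp add: powr_minus_divide powr_divide)
    finally have "s / r ^ p = (1 / s) powr ?e" .
    moreover have "M / 2 * r ^ p < C * L * s" using rej' n by linarith
    then have "M < 2 * (C * L) * (s / r ^ p)"
      using \<open>r > 0\<close> by (simp add: field_simps)
    ultimately show ?thesis by simp
  qed
  ultimately have "M < 2 * (C * L) * (3 * D * (C * L) / \<epsilon>) powr ?e"
    using C_pos L_pos by (smt (verit) mult_left_mono mult_pos_pos)
  then show ?thesis
    using M_const_eq[where \<nu> = \<nu> and Hc = Hc, OF p \<nu> D(1) holder(2) L_pos \<epsilon>] by simp
qed

lemma rejected_trial_less: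
  assumes "\<epsilon> \<le> strong_gap Z F (trial k i)" "\<not> accepts (zk k) (Hk k) i"
  shows "Hk k * 2 ^ i < M\<nu>"
  using assms Hk_pos[of k] by (intro rejected_less[OF zk_in]) (auto simp: trial_def accepts_iff)

section \<open>Termination of the line searches and bounds on the regularization constants\<close>

definition large_gaps :: "nat \<Rightarrow> bool"
  where "large_gaps K \<longleftrightarrow> (\<forall>k<K. \<forall>i. generated k i \<longrightarrow> strong_gap Z F (trial k i) \<ge> \<epsilon>)"

text \<open>In a search that never stops, all trial points are generated and rejected, so
  \<open>Hk k * 2 ^ i\<close> would stay below \<open>M\<nu>\<close> for every \<open>i\<close>.
  Strong induction is used because a trial point counts as generated only if all earlier searches
  terminate.\<close>

lemma terminates_if_large_gaps:
  assumes "large_gaps K" "k < K"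
  shows "terminates k"
  using assms(2)
proof (induction k rule: less_induct)
  case (less k)
  show ?case
  proof (rule ccontr)
    assume non: "\<not> terminates k"
    have "Hk k * 2 ^ i < M\<nu>" for i
    proof (rule rejected_trial_less)
      have "generated k i"
        using non less by (auto simp: generated_def terminates_def)
      then show "\<epsilon> \<le> strong_gap Z F (trial k i)"
        using assms less by (auto simp: large_gaps_def)
    qed (use non in \<open>auto simp: terminates_def\<close>)
    moreover obtain i where "M\<nu> / Hk k < 2 ^ i"
      using real_arch_pow[of 2] by auto
    ultimately show False
      using Hk_pos[of k] by (smt (verit) mult.commute pos_divide_less_eq)
  qed
qed

lemma generated_if_large_gaps:
  assumes "large_gaps K" "k < K" "i \<le> ik k"
  shows "generated k i"
proof -
  have "\<not> accepts (zk k) (Hk k) i'" if "i' < i" for i'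
    using that assms(3) not_less_Least[of i' "accepts (zk k) (Hk k)"]
    by (auto simp: ik_def search_def)
  then show ?thesis
    using assms terminates_if_large_gaps[OF assms(1)] by (auto simp: generated_def)
qed

lemma accepts_ik: "terminates k \<Longrightarrow> accepts (zk k) (Hk k) (ik k)"
  unfolding terminates_def ik_def search_def by (rule LeastI_ex)

text \<open>If the accepted index is positive, the trial just before it was rejected with half the
  constant, which \<open>rejected_trial_less\<close> bounds by \<open>M\<nu>\<close>.\<close>

lemma Mk_le:
  assumes "large_gaps K" "k < K" "Hk k \<le> M\<nu>"
  shows "Mk k \<le> 2 * M\<nu>"
proof (cases "ik k")
  case 0
  then show ?thesis using assms(3) M\<nu>_pos by (simp add: Mk_def)
next
  case (Suc i)
  then have "generated k i" using generated_if_large_gaps[OF assms(1,2)] by simp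
  then have "\<epsilon> \<le> strong_gap Z F (trial k i)" using assms by (auto simp: large_gaps_def)
  moreover have "\<not> accepts (zk k) (Hk k) i"
    using Suc not_less_Least[of i "accepts (zk k) (Hk k)"] by (auto simp: ik_def search_def)
  ultimately have "Hk k * 2 ^ i < M\<nu>" by (rule rejected_trial_less)
  then show ?thesis using Suc by (simp add: Mk_def)
qed

text \<open>The halving in \<open>Hk_Suc\<close> undoes the factor 2 of \<open>Mk_le\<close>, so the
  bound reproduces itself.\<close>

lemma Hk_le: "large_gaps k \<Longrightarrow> Hk k \<le> M\<nu>"
proof (induction k)
  case 0
  then show ?case using H0_le by (simp add: Hk_def)
next
  case (Suc k)
  have "large_gaps k" using Suc.prems by (auto simp: large_gaps_def)
  then show ?case
    using Mk_le[OF Suc.prems, of k] Suc.IH by (simp add: Hk_Suc)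
qed

lemma Mk_le_twice: "large_gaps K \<Longrightarrow> k < K \<Longrightarrow> Mk k \<le> 2 * M\<nu>"
  by (rule Mk_le) (auto intro!: Hk_le simp: large_gaps_def)

section \<open>Step lengths and the extragradient inequality\<close>

lemma model_error:
  assumes "terminates k"
  shows "norm (F (zhalf k) - taylor_model p DF (zk k) (zhalf k)) \<le> Mk k / 2 * rk k ^ p"
  using accepts_ik[OF assms] by (simp add: accepts_iff zhalf_def trial_def Mk_def)

lemma zhalf_eq: "zhalf k = T (zk k) (Mk k)"
  by (simp add: zhalf_def trial_def Mk_def)

text \<open>An accepted trial point at distance 0 would have no model error and hence no positive
  gap. Positive step lengths make the weights \<open>inverse (\<gamma>k k)\<close>
  meaningful.\<close>

lemma rk_pos:
  assumes "large_gaps K" "k < K"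
  shows "rk k > 0"
proof (rule ccontr)
  assume "\<not> rk k > 0"
  then have "rk k = 0" by simp
  have "\<epsilon> \<le> strong_gap Z F (zhalf k)"
    using assms generated_if_large_gaps[OF assms] by (auto simp: large_gaps_def zhalf_def)
  also have "\<dots> \<le> D * (norm (F (zhalf k) - taylor_model p DF (zk k) (zhalf k)) + Mk k * rk k ^ p)"
    using strong_gap_T_le[OF zk_in Mk_pos] by (simp add: zhalf_eq)
  also have "\<dots> \<le> D * (Mk k / 2 * rk k ^ p + Mk k * rk k ^ p)"
    using model_error[OF terminates_if_large_gaps[OF assms]] D(1) by (intro mult_left_mono) auto
  also have "\<dots> = 0" using \<open>rk k = 0\<close> p by simp
  finally show False using \<epsilon> by simp
qed

lemma \<gamma>k_pos: "large_gaps K \<Longrightarrow> k < K \<Longrightarrow> \<gamma>k k > 0"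
  using rk_pos Mk_pos by (auto simp: \<gamma>k_def)

text \<open>Three bounds are added: optimality of the prox step tested at \<open>u\<close>, the
  model variational inequality tested at the next iterate \<open>x\<close>, and the acceptance test,
  which bounds the model error by \<open>g * r / 2\<close>.\<close>

lemma extragradient_step:
  assumes "terminates k" and u: "u \<in> Z"
  shows "inner (F (zhalf k)) (zhalf k - u)
    \<le> \<gamma>k k * (((norm (zk k - u))\<^sup>2 - (norm (zk (Suc k) - u))\<^sup>2) / 2 - (rk k)\<^sup>2 / 4)"
proof -
  define y z x g r s where "y = zhalf k" and "z = zk k" and "x = zk (Suc k)" and "g = \<gamma>k k"
    and "r = rk k" and "s = norm (y - x)"
  define t where "t = taylor_model p DF z y"
  have g: "g \<ge> 0" using Mk_pos[of k] by (simp add: g_def \<gamma>k_def)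
  have x: "x \<in> Z" by (simp add: x_def zk_in)
  have "0 \<le> inner (F y + g *\<^sub>R (x - z)) (u - x)"
    using prox_optimality(2)[OF compact_Z Z(3,1) u] by (simp add: x_def y_def z_def g_def zk_Suc)
  then have 1: "inner (F y) (x - u) \<le> g * inner (x - z) (u - x)"
    by (simp add: inner_add_left inner_diff_right algebra_simps)
  have "0 \<le> inner (reg_model p DF (Mk k) z y) (x - y)"
    using T_VI[OF zk_in Mk_pos x] by (simp add: y_def z_def zhalf_eq)
  also have "reg_model p DF (Mk k) z y = t + g *\<^sub>R (y - z)"
    by (simp add: reg_model_def t_def g_def \<gamma>k_def y_def z_def)
  finally have 2: "inner t (y - x) \<le> g * inner (y - z) (x - y)"
    by (simp add: inner_add_left inner_diff_right algebra_simps)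
  have "norm (F y - t) \<le> Mk k / 2 * r ^ p"
    using model_error[OF assms(1)] by (simp add: y_def z_def t_def r_def)
  also have "\<dots> = g * r / 2"
    using p by (simp add: g_def \<gamma>k_def r_def power_eq_if)
  finally have "norm (F y - t) * s \<le> g * r / 2 * s"
    by (rule mult_right_mono) (simp add: s_def)
  then have 3: "inner (F y - t) (y - x) \<le> g * r / 2 * s"
    using norm_cauchy_schwarz[of "F y - t" "y - x"] by (simp add: s_def)
  \<comment> \<open>Young's inequality: half of the quadratic terms gained from the model inequality
    pays for the model error, and a quarter of \<open>r\<^sup>2\<close> survives.\<close>
  have "r * s \<le> (r\<^sup>2 + s\<^sup>2) / 2"
    using sum_squares_ge_zero[of "r - s" 0] by (simp add: power2_eq_square algebra_simps)
  then have 4: "g / 2 * (r * s) \<le> g / 2 * ((r\<^sup>2 + s\<^sup>2) / 2)"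
    using g by (intro mult_left_mono) auto
  have "inner (F y) (y - u) = inner (F y) (x - u) + (inner (F y - t) (y - x) + inner t (y - x))"
    by (simp add: inner_diff_left inner_diff_right)
  also have "\<dots> \<le> g * inner (x - z) (u - x) + (g * r / 2 * s + g * inner (y - z) (x - y))"
    using 1 2 3 by (intro add_mono)
  \<comment> \<open>By the three-point identity the squared distance between \<open>x\<close> and
    \<open>z\<close> occurs with both signs and cancels.\<close>
  also have "\<dots> \<le> g * (((norm (z - u))\<^sup>2 - (norm (x - u))\<^sup>2) / 2 - r\<^sup>2 / 4) - g / 4 * s\<^sup>2"
    using 4 unfolding inner_three_point
    by (simp add: r_def y_def z_def s_def norm_minus_commute[of "zk k" x] algebra_simps add_divide_distrib diff_divide_distrib)
  also have "\<dots> \<le> g * (((norm (z - u))\<^sup>2 - (norm (x - u))\<^sup>2) / 2 - r\<^sup>2 / 4)"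
    using g by simp
  finally show ?thesis by (simp add: y_def z_def x_def g_def r_def)
qed

section \<open>Convergence of the averaged point\<close>

definition weight :: "nat \<Rightarrow> real"
  where "weight K = (\<Sum>k<K. inverse (\<gamma>k k))"

lemma weight_pos: "large_gaps K \<Longrightarrow> K \<ge> 1 \<Longrightarrow> weight K > 0"
  unfolding weight_def using \<gamma>k_pos by (intro sum_pos) (auto simp: lessThan_empty_iff)

lemma average_in:
  assumes "large_gaps K" "K \<ge> 1"
  shows "average K \<in> Z"
proof -
  have "(\<Sum>k<K. (inverse (\<gamma>k k) / weight K) *\<^sub>R zhalf k) \<in> Z"
  proof (rule convex_sum[OF _ Z(3)])
    show "(\<Sum>k<K. inverse (\<gamma>k k) / weight K) = 1"
      using weight_pos[OF assms] by (simp add: weight_def flip: sum_divide_distrib)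
    show "0 \<le> inverse (\<gamma>k k) / weight K" if "k \<in> {..<K}" for k
      using weight_pos[OF assms] \<gamma>k_pos[OF assms(1), of k] that by simp
  qed (auto simp: zhalf_in)
  then show ?thesis
    by (simp add: average_def scaleR_sum_right divide_inverse mult.commute flip: weight_def)
qed

text \<open>Monotonicity replaces the operator at \<open>zhalf k\<close> by its value at
  \<open>u\<close>, which makes the left-hand side linear in the points averaged. After division by
  \<open>\<gamma>k k\<close> the squared distances in \<open>extragradient_step\<close>
  telescope.\<close>

lemma weighted_gap:
  assumes "large_gaps K" "K \<ge> 1" and u: "u \<in> Z"
  shows "weight K * inner (F u) (average K - u) + (\<Sum>k<K. (rk k)\<^sup>2) / 4 \<le> D\<^sup>2 / 2"
proof -
  have "weight K *\<^sub>R average K = (\<Sum>k<K. inverse (\<gamma>k k) *\<^sub>R zhalf k)"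
    using weight_pos[OF assms(1,2)] by (simp add: average_def flip: weight_def)
  then have "weight K *\<^sub>R (average K - u) = (\<Sum>k<K. inverse (\<gamma>k k) *\<^sub>R (zhalf k - u))"
    by (simp add: weight_def scaleR_diff_right sum_subtractf scaleR_sum_left)
  then have "weight K * inner (F u) (average K - u)
      = (\<Sum>k<K. inverse (\<gamma>k k) * inner (F u) (zhalf k - u))"
    by (metis (mono_tags, lifting) inner_scaleR_right inner_sum_right sum.cong)
  also have "\<dots> \<le> (\<Sum>k<K. ((norm (zk k - u))\<^sup>2 - (norm (zk (Suc k) - u))\<^sup>2) / 2 - (rk k)\<^sup>2 / 4)"
  proof (rule sum_mono)
    fix k assume "k \<in> {..<K}"
    then have k: "k < K" by simp
    have "inner (F u) (zhalf k - u) \<le> inner (F (zhalf k)) (zhalf k - u)"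
      using mono[OF zhalf_in u, of k] by (simp add: inner_diff_left)
    also have "\<dots> \<le> \<gamma>k k * (((norm (zk k - u))\<^sup>2 - (norm (zk (Suc k) - u))\<^sup>2) / 2 - (rk k)\<^sup>2 / 4)"
      by (rule extragradient_step[OF terminates_if_large_gaps[OF assms(1) k] u])
    finally show "inverse (\<gamma>k k) * inner (F u) (zhalf k - u)
        \<le> ((norm (zk k - u))\<^sup>2 - (norm (zk (Suc k) - u))\<^sup>2) / 2 - (rk k)\<^sup>2 / 4"
      using \<gamma>k_pos[OF assms(1) k] by (simp add: field_simps)
  qed
  also have "\<dots> = (\<Sum>k<K. (norm (zk k - u))\<^sup>2 - (norm (zk (Suc k) - u))\<^sup>2) / 2 - (\<Sum>k<K. (rk k)\<^sup>2) / 4"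
    by (simp only: sum_subtractf[of _ "\<lambda>k. (rk k)\<^sup>2 / 4"] sum_divide_distrib)
  also have "(\<Sum>k<K. (norm (zk k - u))\<^sup>2 - (norm (zk (Suc k) - u))\<^sup>2)
      = (norm (zk 0 - u))\<^sup>2 - (norm (zk K - u))\<^sup>2"
    by (rule sum_lessThan_telescope')
  also have "\<dots> \<le> D\<^sup>2"
    using power_mono[OF D(2)[OF zk_in u, of 0] norm_ge_zero, of 2] zero_le_power2[of "norm (zk K - u)"] by linarith
  finally show ?thesis by (simp add: divide_right_mono)
qed

text \<open>Choosing the average itself as the reference point makes the gap term vanish, so that the
  existence of a solution is not needed.\<close>

lemma sum_rk_le:
  assumes "large_gaps K" "K \<ge> 1"
  shows "(\<Sum>k<K. (rk k)\<^sup>2) \<le> 2 * D\<^sup>2"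
  using weighted_gap[OF assms average_in[OF assms]] by simp

lemma weak_gap_average_le:
  assumes "large_gaps K" "K \<ge> 1"
  shows "weak_gap Z F (average K) \<le> D\<^sup>2 / (2 * weight K)"
  unfolding weak_gap_def
proof (rule cSUP_least[OF Z(1)])
  fix u assume "u \<in> Z"
  from weighted_gap[OF assms this]
  have "weight K * inner (F u) (average K - u) \<le> D\<^sup>2 / 2"
    using sum_nonneg[of "{..<K}" "\<lambda>k. (rk k)\<^sup>2"] by simp
  then show "inner (F u) (average K - u) \<le> D\<^sup>2 / (2 * weight K)"
    using weight_pos[OF assms] by (simp add: field_simps)
qed

text \<open>Each weight is at least \<open>rk k ^ (p - 1)\<close> inverted and divided by
  \<open>2 * M\<nu>\<close>. The power mean inequality is applied to the squared step lengths, with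
  \<open>B = 2 * D\<^sup>2\<close> from \<open>sum_rk_le\<close>.\<close>

lemma weight_ge:
  assumes "large_gaps K" "K \<ge> 1"
  shows "real K * (2 * D\<^sup>2 / real K) powr (- ((real p - 1) / 2)) / (2 * M\<nu>) \<le> weight K"
proof -
  let ?a = "(real p - 1) / 2"
  have "real K * (2 * D\<^sup>2 / real K) powr (- ?a) \<le> (\<Sum>k<K. ((rk k)\<^sup>2) powr (- ?a))"
    using rk_pos[OF assms(1)] sum_rk_le[OF assms] assms(2) D(1) p
    by (intro power_mean_inverse) auto
  also have "\<dots> \<le> (\<Sum>k<K. 2 * M\<nu> * inverse (\<gamma>k k))"
  proof (rule sum_mono)
    fix k assume "k \<in> {..<K}"
    then have k: "k < K" by simp
    have r: "rk k > 0" by (rule rk_pos[OF assms(1) k])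
    have "((rk k)\<^sup>2) powr (- ?a) = inverse (rk k ^ (p - 1))"
      using power2_powr_half[of "rk k" p] r p by (simp add: powr_minus)
    also have "\<dots> = Mk k * inverse (\<gamma>k k)"
      using Mk_pos[of k] by (simp add: \<gamma>k_def)
    also have "\<dots> \<le> 2 * M\<nu> * inverse (\<gamma>k k)"
      using Mk_le_twice[OF assms(1) k] \<gamma>k_pos[OF assms(1) k] by (intro mult_right_mono) auto
    finally show "((rk k)\<^sup>2) powr (- ?a) \<le> 2 * M\<nu> * inverse (\<gamma>k k)" .
  qed
  also have "\<dots> = 2 * M\<nu> * weight K"
    by (simp add: weight_def sum_distrib_left)
  finally show ?thesis using M\<nu>_pos by (simp add: field_simps)
qed

lemma weak_gap_bound:
  assumes "large_gaps K" "K \<ge> 1"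
  shows "weak_gap Z F (average K)
    \<le> 2 powr ((real p - 1) / 2) * (M\<nu> * D ^ (p + 1) / real K powr (real (p + 1) / 2))"
proof -
  let ?a = "(real p - 1) / 2"
  let ?w = "real K * (2 * D\<^sup>2 / real K) powr (- ?a) / (2 * M\<nu>)"
  have w: "?w > 0" using assms(2) D(1) M\<nu>_pos by simp
  have "weak_gap Z F (average K) \<le> D\<^sup>2 / (2 * weight K)"
    by (rule weak_gap_average_le[OF assms])
  also have "\<dots> \<le> D\<^sup>2 / (2 * ?w)"
    using weight_ge[OF assms] w weight_pos[OF assms]
    by (intro divide_left_mono mult_left_mono mult_pos_pos) auto
  also have "\<dots> = M\<nu> * D\<^sup>2 * (2 * D\<^sup>2 / real K) powr ?a / real K"
    using M\<nu>_pos D(1) assms(2) by (simp add: powr_minus field_simps)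
  also have "(2 * D\<^sup>2 / real K) powr ?a = 2 powr ?a * D ^ (p - 1) / real K powr ?a"
    using D(1) assms(2) p power2_powr_half[of D p] by (simp add: powr_mult powr_divide)
  also have "M\<nu> * D\<^sup>2 * (2 powr ?a * D ^ (p - 1) / real K powr ?a) / real K
      = 2 powr ?a * (M\<nu> * (D\<^sup>2 * D ^ (p - 1)) / (real K powr ?a * real K))"
    by simp
  also have "D\<^sup>2 * D ^ (p - 1) = D ^ (p + 1)"
    using p by (simp flip: power_add)
  also have "real K powr ?a * real K = real K powr (?a + 1)"
    using assms(2) by (simp add: powr_add)
  also have "?a + 1 = real (p + 1) / 2" by (simp add: field_simps)
  finally show ?thesis .
qed

section \<open>Counting oracle calls\<close>

lemma calls_eq: "real (calls k) = 2 * real k + log 2 (Hk k / H0)"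
proof (induction k)
  case 0
  then show ?case using H0_pos by (simp add: calls_def Hk_def)
next
  case (Suc k)
  have "Hk (Suc k) / H0 = (Hk k / H0) * (2 ^ ik k / 2)"
    by (simp add: Hk_Suc Mk_def)
  moreover have "log 2 ((Hk k / H0) * (2 ^ ik k / 2)) = log 2 (Hk k / H0) + log 2 (2 ^ ik k / 2)"
    using Hk_pos[of k] H0_pos by (intro log_mult_pos) auto
  moreover have "log 2 (2 ^ ik k / 2) = real (ik k) - 1"
    by (simp add: log_divide_pos)
  ultimately have "log 2 (Hk (Suc k) / H0) = log 2 (Hk k / H0) + (real (ik k) - 1)"
    by simp
  then show ?case using Suc by (simp add: calls_def)
qed

text \<open>If not all gaps are large, the first trial point with a small gap is reached early, since
  every trial point before it obeys the bound for rejected points.\<close>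

lemma calls_dichotomy:
  "(\<exists>k<K. \<exists>i. generated k i \<and> real (calls k + i + 1) \<le> 2 * real K + log 2 (M\<nu> / H0) \<and>
      strong_gap Z F (trial k i) < \<epsilon>) \<or>
   (large_gaps K \<and> real (calls K) \<le> 2 * real K + log 2 (M\<nu> / H0))"
proof (cases "large_gaps K")
  case True
  then have "log 2 (Hk K / H0) \<le> log 2 (M\<nu> / H0)"
    using Hk_le Hk_pos[of K] H0_pos M\<nu>_pos by (simp add: divide_right_mono)
  then show ?thesis using True calls_eq[of K] by simp
next
  case False
  define P where "P = (\<lambda>k i. generated k i \<and> strong_gap Z F (trial k i) < \<epsilon>)"
  \<comment> \<open>The pair \<open>k\<close>, \<open>i\<close> is the first generated trial point
    with a small gap, in order of generation.\<close>
  define k where "k = (LEAST k. \<exists>i. P k i)"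
  define i where "i = (LEAST i. P k i)"
  obtain k' i' where k': "k' < K" "P k' i'"
    using False by (auto simp: large_gaps_def P_def not_le)
  have "\<exists>i. P k i" unfolding k_def by (rule LeastI[of _ k']) (use k' in blast)
  then have Pki: "P k i" unfolding i_def by (rule LeastI_ex)
  have "k \<le> k'" unfolding k_def by (rule Least_le) (use k' in blast)
  then have kK: "k < K" using k' by simp
  have "\<not> P j l" if "j < k" for j l
    using not_less_Least[of j "\<lambda>k. \<exists>i. P k i"] that by (auto simp: k_def)
  then have lg: "large_gaps k" by (force simp: large_gaps_def P_def not_less)
  have "Hk k * 2 ^ i \<le> 2 * M\<nu>"
  proof (cases i)
    case 0
    then show ?thesis using Hk_le[OF lg] M\<nu>_pos by simp
  next
    case (Suc l)
    have "\<not> P k l" using not_less_Least[of l "P k"] Suc by (auto simp: i_def)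
    moreover have "generated k l" "\<not> accepts (zk k) (Hk k) l"
      using Pki Suc by (auto simp: P_def generated_def)
    ultimately have "Hk k * 2 ^ l < M\<nu>"
      by (intro rejected_trial_less) (auto simp: P_def)
    then show ?thesis using Suc by simp
  qed
  then have "log 2 (Hk k / H0 * 2 ^ i) \<le> log 2 (2 * (M\<nu> / H0))"
    using Hk_pos[of k] H0_pos M\<nu>_pos by (simp add: divide_right_mono)
  moreover have "log 2 (Hk k / H0 * 2 ^ i) = log 2 (Hk k / H0) + log 2 (2 ^ i)"
    using Hk_pos[of k] H0_pos by (intro log_mult_pos) auto
  moreover have "log 2 (2 * (M\<nu> / H0)) = log 2 2 + log 2 (M\<nu> / H0)"
    using H0_pos M\<nu>_pos by (intro log_mult_pos) auto
  ultimately have "log 2 (Hk k / H0) + real i \<le> 1 + log 2 (M\<nu> / H0)"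
    by simp
  \<comment> \<open>The trial in progress costs \<open>i + 1\<close> further calls; the surplus 2 is
    covered by \<open>k + 1 \<le> K\<close>.\<close>
  then have "real (calls k + i + 1) \<le> 2 * real K + log 2 (M\<nu> / H0)"
    using calls_eq[of k] kK by simp
  then show ?thesis using Pki kK by (auto simp: P_def)
qed

text \<open>Monotonicity compares the two gaps at the same \<open>u\<close>. Boundedness of the
  strong gap's values is what makes its supremum an upper bound.\<close>

lemma weak_gap_le_strong_gap:
  assumes "z \<in> Z"
  shows "weak_gap Z F z \<le> strong_gap Z F z"
  unfolding weak_gap_def strong_gap_def
proof (rule cSUP_mono[OF Z(1)])
  have "inner (F z) (z - u) \<le> norm (F z) * D" if "u \<in> Z" for u
    using norm_cauchy_schwarz[of "F z" "z - u"] mult_left_mono[OF D(2)[OF assms that] norm_ge_zero]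
      order_trans by blast
  then show "bdd_above ((\<lambda>u. inner (F z) (z - u)) ` Z)"
    by (auto simp: bdd_above_def)
  fix u assume u: "u \<in> Z"
  show "\<exists>v\<in>Z. inner (F u) (z - u) \<le> inner (F z) (z - v)"
    using mono[OF assms u] u by (intro bexI[of _ u]) (auto simp: inner_diff_left)
qed

lemma weak_gap_bound_explicit:
  assumes "large_gaps K" "K \<ge> 1"
  shows "weak_gap Z F (average K)
    \<le> 2 powr ((real p - 1) / 2) * 2 * C * (3 * C) powr ((1 - \<nu>) / (real p - 1 + \<nu>))
      * (L powr (real p / (real p - 1 + \<nu>))
          * D powr (real p + 1 + (1 - \<nu>) / (real p - 1 + \<nu>))
          / (\<epsilon> powr ((1 - \<nu>) / (real p - 1 + \<nu>)) * real K powr (real (p + 1) / 2)))"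
proof -
  have "D powr (real p + 1 + (1 - \<nu>) / (real p - 1 + \<nu>))
      = D powr real (p + 1) * D powr ((1 - \<nu>) / (real p - 1 + \<nu>))"
    by (simp add: powr_add)
  also have "D powr real (p + 1) = D ^ (p + 1)"
    using D(1) by (rule powr_realpow)
  finally show ?thesis
    using weak_gap_bound[OF assms]
    by (simp add: M_const_explicit[where \<nu> = \<nu> and Hc = Hc, OF p \<nu> D(1) holder(2) L_pos \<epsilon>] mult_ac)
qed

text \<open>The assumption on \<open>K\<close> makes the explicit gap bound at most
  \<open>\<epsilon>\<close>. Either a trial point with small strong gap comes early, or all gaps are
  large and this bound applies to the average.\<close>

lemma weak_solution_within_calls:
  assumes "K \<ge> 1"
    and "2 powr ((real p - 1) / 2) * 2 * C * (3 * C) powr ((1 - \<nu>) / (real p - 1 + \<nu>))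
      * (L powr (real p / (real p - 1 + \<nu>))
          * D powr (real p + 1 + (1 - \<nu>) / (real p - 1 + \<nu>))
          / (\<epsilon> powr ((1 - \<nu>) / (real p - 1 + \<nu>)) * real K powr (real (p + 1) / 2))) \<le> \<epsilon>"
    and "2 * real K + log 2 (M\<nu> / H0) \<le> N"
  shows "(\<exists>k<K. \<exists>i. generated k i \<and> real (calls k + i + 1) \<le> N \<and> weak_solution Z F \<epsilon> (trial k i)) \<or>
    ((\<forall>k<K. terminates k) \<and> real (calls K) \<le> N \<and> weak_solution Z F \<epsilon> (average K))"
  using calls_dichotomy[of K]
proof (elim disjE exE conjE)
  fix k i
  assume *: "k < K" "generated k i" "real (calls k + i + 1) \<le> 2 * real K + log 2 (M\<nu> / H0)"
    "strong_gap Z F (trial k i) < \<epsilon>"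
  then have "weak_solution Z F \<epsilon> (trial k i)"
    using weak_gap_le_strong_gap[OF trial_in, of k i] trial_in by (simp add: weak_solution_def)
  then show ?thesis using * assms(3) by (meson order_trans)
next
  assume *: "large_gaps K" "real (calls K) \<le> 2 * real K + log 2 (M\<nu> / H0)"
  then have "weak_solution Z F \<epsilon> (average K)"
    using weak_gap_bound_explicit[OF _ assms(1)] average_in[OF _ assms(1)] assms(2)
    by (auto simp: weak_solution_def)
  then show ?thesis using * terminates_if_large_gaps[OF *(1)] assms(3) by auto
qed

end

text \<open>Here \<open>\<kappa>\<close> stands for the number of iterations. Its lower bound is the
  value at which the gap bound equals \<open>\<epsilon>\<close>, as raising it to the power
  \<open>(p + 1) / 2\<close> shows; \<open>e1\<close> and \<open>e2\<close> compute the resulting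
  exponents.\<close>

lemma iterations_suffice:
  fixes c L D \<epsilon> \<kappa> :: real
  assumes "p \<ge> 2" "0 \<le> \<nu>" "c > 0" "L > 0" "D > 0" "\<epsilon> > 0"
    and \<kappa>: "\<kappa> \<ge> c powr (2 / (real p + 1))
      * (L powr (2 * real p / ((real p + 1) * (real p - 1 + \<nu>)))
        * D powr (2 + 2 * (1 - \<nu>) / ((real p + 1) * (real p - 1 + \<nu>)))
        * \<epsilon> powr (- (2 * real p / ((real p + 1) * (real p - 1 + \<nu>)))))"
  shows "c * (L powr (real p / (real p - 1 + \<nu>)) * D powr (real p + 1 + (1 - \<nu>) / (real p - 1 + \<nu>))
      / (\<epsilon> powr ((1 - \<nu>) / (real p - 1 + \<nu>)) * \<kappa> powr (real (p + 1) / 2))) \<le> \<epsilon>"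
proof -
  let ?q = "real p - 1 + \<nu>" and ?h = "real (p + 1) / 2"
  let ?X = "c * (L powr (real p / ?q) * D powr (real p + 1 + (1 - \<nu>) / ?q))"
  have q: "?q > 0" using assms(1,2) by simp
  have h: "2 / (real p + 1) * ?h = 1" by simp
  have h': "2 / (real p + 1) * x * ?h = x" for x
  proof -
    have "2 / (real p + 1) * x * ?h = x * (2 / (real p + 1) * ?h)" by (simp only: ac_simps)
    then show ?thesis by (simp only: h mult_1_right)
  qed
  have e1: "2 * real p / ((real p + 1) * ?q) * ?h = real p / ?q"
  proof -
    have "2 * real p / ((real p + 1) * ?q) = 2 / (real p + 1) * (real p / ?q)" by simp
    then show ?thesis by (simp only: h')
  qed
  have e2: "(2 + 2 * (1 - \<nu>) / ((real p + 1) * ?q)) * ?h = real p + 1 + (1 - \<nu>) / ?q"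
  proof -
    have "2 + 2 * (1 - \<nu>) / ((real p + 1) * ?q) = 2 / (real p + 1) * (real p + 1 + (1 - \<nu>) / ?q)"
    proof -
      define P where "P = real p + 1"
      have "P \<noteq> 0" by (simp add: P_def)
      then show ?thesis unfolding P_def[symmetric] by (simp add: distrib_left)
    qed
    then show ?thesis by (simp only: h')
  qed
  have "?X * \<epsilon> powr (- (real p / ?q))
      = (c powr (2 / (real p + 1))
        * (L powr (2 * real p / ((real p + 1) * ?q))
          * D powr (2 + 2 * (1 - \<nu>) / ((real p + 1) * ?q))
          * \<epsilon> powr (- (2 * real p / ((real p + 1) * ?q))))) powr ?h"
    using assms(3) by (simp only: powr_mult powr_powr mult_minus_left h e1 e2 powr_one)
  also have "\<dots> \<le> \<kappa> powr ?h"
    using \<kappa> by (intro powr_mono2) auto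
  finally have "?X * \<epsilon> powr (- (real p / ?q)) \<le> \<kappa> powr ?h" .
  then have "\<epsilon> powr ((1 - \<nu>) / ?q) * (?X * \<epsilon> powr (- (real p / ?q))) * \<epsilon>
      \<le> \<epsilon> powr ((1 - \<nu>) / ?q) * \<kappa> powr ?h * \<epsilon>"
    using assms(6) by (intro mult_right_mono mult_left_mono) auto
  moreover have "\<epsilon> powr ((1 - \<nu>) / ?q) * (?X * \<epsilon> powr (- (real p / ?q))) * \<epsilon> = ?X"
  proof -
    have "real p / ?q = (1 - \<nu>) / ?q + 1" using q by (simp add: field_simps)
    then have "\<epsilon> powr (- (real p / ?q)) = inverse (\<epsilon> powr ((1 - \<nu>) / ?q) * \<epsilon>)"
      using assms(6) by (simp only: powr_minus powr_add powr_one less_imp_le)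
    then show ?thesis using assms(6) by simp
  qed
  ultimately have "?X \<le> \<epsilon> * (\<epsilon> powr ((1 - \<nu>) / ?q) * \<kappa> powr ?h)"
    by (simp only: mult.commute[of _ \<epsilon>])
  moreover have "\<kappa> > 0"
    using assms(3-6) by (intro less_le_trans[OF _ \<kappa>] mult_pos_pos) auto
  then have "\<epsilon> powr ((1 - \<nu>) / ?q) * \<kappa> powr ?h > 0" using assms(6) by simp
  ultimately show ?thesis
    by (simp only: times_divide_eq_right pos_divide_le_eq)
qed

section \<open>Constants and both parts of the theorem\<close>

theorem theorem4p2:
  fixes p :: nat and \<nu> :: real
  assumes "p \<ge> 2" and "0 \<le> \<nu>" and "\<nu> \<le> 1"
  shows "\<exists>C1>0. \<exists>C2>0. \<exists>C3>0.
    \<forall>(d :: nat) (Z :: fsv set) (F :: fsv \<Rightarrow> fsv) (DF :: nat \<Rightarrow> fsv \<Rightarrow> fsv list \<Rightarrow> fsv)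
      (D :: real) (Hc :: real \<Rightarrow> ennreal) (z0 :: fsv) (H0 :: real).
      Z \<noteq> {} \<and> closed Z \<and> convex Z \<and> Z \<subseteq> Rd d \<and> F ` Z \<subseteq> Rd d \<and>
      derivs d Z F (p - 1) DF \<and>
      (\<forall>z\<in>Z. \<forall>u\<in>Z. inner (F z - F u) (z - u) \<ge> 0) \<and>
      D > 0 \<and> (\<forall>z\<in>Z. \<forall>u\<in>Z. norm (z - u) \<le> D) \<and>
      holder_constants d Z p DF Hc \<and> Hc \<nu> < \<infinity> \<and>
      z0 \<in> Z \<longrightarrow>
      (\<forall>\<epsilon>>0. \<forall>K\<ge>1. \<forall>T.
        admissible p D Hc \<epsilon> H0 \<and> model_solver Z p DF T \<and>
        (\<forall>k<K. \<forall>i. uteg.generated Z p F DF T z0 H0 k i \<longrightarrow>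
          strong_gap Z F (uteg.trial Z p F DF T z0 H0 k i) \<ge> \<epsilon>) \<longrightarrow>
        (\<forall>k<K. uteg.terminates Z p F DF T z0 H0 k) \<and>
        weak_gap Z F (uteg.average Z p F DF T z0 H0 K)
          \<le> C1 * (enn2real (M_const p D Hc \<epsilon> \<nu>) * D ^ (p + 1) / real K powr (real (p + 1) / 2)) \<and>
        weak_gap Z F (uteg.average Z p F DF T z0 H0 K)
          \<le> C2 * (enn2real (Hc \<nu>) powr (real p / (real p - 1 + \<nu>))
                  * D powr (real p + 1 + (1 - \<nu>) / (real p - 1 + \<nu>))
                  / (\<epsilon> powr ((1 - \<nu>) / (real p - 1 + \<nu>)) * real K powr (real (p + 1) / 2)))) \<and>
      (\<exists>\<epsilon>0>0. \<forall>\<epsilon>. 0 < \<epsilon> \<and> \<epsilon> < \<epsilon>0 \<and> admissible p D Hc \<epsilon> H0 \<longrightarrow>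
        (\<exists>K\<ge>1. \<forall>T. model_solver Z p DF T \<longrightarrow>
          (let N = C3 * (enn2real (Hc \<nu>) powr (2 * real p / ((real p + 1) * (real p - 1 + \<nu>)))
                         * D powr (2 + 2 * (1 - \<nu>) / ((real p + 1) * (real p - 1 + \<nu>)))
                         * \<epsilon> powr (- (2 * real p / ((real p + 1) * (real p - 1 + \<nu>)))))
           in (\<exists>k<K. \<exists>i. uteg.generated Z p F DF T z0 H0 k i \<and>
                 real (uteg.calls Z p F DF T z0 H0 k + i + 1) \<le> N \<and>
                 weak_solution Z F \<epsilon> (uteg.trial Z p F DF T z0 H0 k i)) \<or>
              ((\<forall>k<K. uteg.terminates Z p F DF T z0 H0 k) \<and>
               real (uteg.calls Z p F DF T z0 H0 K) \<le> N \<and>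
               weak_solution Z F \<epsilon> (uteg.average Z p F DF T z0 H0 K)))))"
proof -
  let ?q = "real p - 1 + \<nu>"
  let ?e = "(1 - \<nu>) / ?q"
  let ?s = "2 * real p / ((real p + 1) * ?q)"
  let ?C = "C_const p \<nu>"
  \<comment> \<open>\<open>C1\<close> comes from the power mean inequality, and \<open>C2\<close>
    adds the numerical factor of \<open>M_const_explicit\<close>. In \<open>C3\<close>, the term
    \<open>2 * c\<close> counts two calls per iteration, and 3 covers rounding \<open>K\<close> up
    (2) and the logarithm (1).\<close>
  define C1 :: real where "C1 = 2 powr ((real p - 1) / 2)"
  define C2 where "C2 = C1 * 2 * ?C * (3 * ?C) powr ?e"
  define c where "c = C2 powr (2 / (real p + 1))"
  define C3 where "C3 = 2 * c + 3"
  have C: "?C > 0" using assms by (intro C_const_pos)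
  have pos: "C1 > 0" "C2 > 0" "c > 0" "C3 > 0"
  proof -
    show "C1 > 0" by (simp add: C1_def)
    then show "C2 > 0" using C by (simp add: C2_def)
    then show "c > 0" by (simp add: c_def)
    then show "C3 > 0" by (simp add: C3_def)
  qed
  have q: "?q > 0" using assms by simp
  then have s: "?s > 0" using assms(1) by (intro divide_pos_pos mult_pos_pos) auto
  have e: "0 \<le> ?e" "?e \<le> 1" using assms by (auto simp: field_simps)
  show ?thesis
  proof (rule exI[of _ C1], rule conjI[OF pos(1)], rule exI[of _ C2], rule conjI[OF pos(2)],
      rule exI[of _ C3], rule conjI[OF pos(4)], intro allI impI, elim conjE)
    fix d Z F DF D Hc z0 H0
    assume Z: "Z \<noteq> {}" "closed Z" "convex Z" "Z \<subseteq> Rd d"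
      and DF: "derivs d Z F (p - 1) DF"
      and mono: "\<forall>z\<in>Z. \<forall>u\<in>Z. inner (F z - F u) (z - u) \<ge> 0"
      and D: "(D::real) > 0" "\<forall>z\<in>Z. \<forall>u\<in>Z. norm (z - u) \<le> D"
      and holder: "holder_constants d Z p DF Hc" "Hc \<nu> < \<infinity>"
      and z0: "z0 \<in> Z"
    let ?L = "enn2real (Hc \<nu>)"
    let ?Y = "\<lambda>\<epsilon>. ?L powr ?s * D powr (2 + 2 * (1 - \<nu>) / ((real p + 1) * ?q)) * \<epsilon> powr (- ?s)"
    have run: "uteg_run Z p F DF T z0 H0 d \<nu> D \<epsilon> Hc"
      if "\<epsilon> > 0" "admissible p D Hc \<epsilon> H0" "model_solver Z p DF T" for T \<epsilon>
      using assms Z DF mono D holder z0 that by unfold_locales auto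
    show "(\<forall>\<epsilon>>0. \<forall>K\<ge>1. \<forall>T.
        admissible p D Hc \<epsilon> H0 \<and> model_solver Z p DF T \<and>
        (\<forall>k<K. \<forall>i. uteg.generated Z p F DF T z0 H0 k i \<longrightarrow>
          strong_gap Z F (uteg.trial Z p F DF T z0 H0 k i) \<ge> \<epsilon>) \<longrightarrow>
        (\<forall>k<K. uteg.terminates Z p F DF T z0 H0 k) \<and>
        weak_gap Z F (uteg.average Z p F DF T z0 H0 K)
          \<le> C1 * (enn2real (M_const p D Hc \<epsilon> \<nu>) * D ^ (p + 1) / real K powr (real (p + 1) / 2)) \<and>
        weak_gap Z F (uteg.average Z p F DF T z0 H0 K)
          \<le> C2 * (?L powr (real p / ?q) * D powr (real p + 1 + ?e)
                  / (\<epsilon> powr ?e * real K powr (real (p + 1) / 2)))) \<and>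
      (\<exists>\<epsilon>0>0. \<forall>\<epsilon>. 0 < \<epsilon> \<and> \<epsilon> < \<epsilon>0 \<and> admissible p D Hc \<epsilon> H0 \<longrightarrow>
        (\<exists>K\<ge>1. \<forall>T. model_solver Z p DF T \<longrightarrow>
          (let N = C3 * ?Y \<epsilon>
           in (\<exists>k<K. \<exists>i. uteg.generated Z p F DF T z0 H0 k i \<and>
                 real (uteg.calls Z p F DF T z0 H0 k + i + 1) \<le> N \<and>
                 weak_solution Z F \<epsilon> (uteg.trial Z p F DF T z0 H0 k i)) \<or>
              ((\<forall>k<K. uteg.terminates Z p F DF T z0 H0 k) \<and>
               real (uteg.calls Z p F DF T z0 H0 K) \<le> N \<and>
               weak_solution Z F \<epsilon> (uteg.average Z p F DF T z0 H0 K)))))"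
      (is "?a \<and> ?b")
    proof
      show ?a
      proof (intro allI impI, elim conjE)
        fix \<epsilon> :: real and K :: nat and T
        assume \<epsilon>: "\<epsilon> > 0" and K: "1 \<le> K" and T: "admissible p D Hc \<epsilon> H0" "model_solver Z p DF T"
          and gaps: "\<forall>k<K. \<forall>i. uteg.generated Z p F DF T z0 H0 k i \<longrightarrow>
            strong_gap Z F (uteg.trial Z p F DF T z0 H0 k i) \<ge> \<epsilon>"
        interpret uteg_run Z p F DF T z0 H0 d \<nu> D \<epsilon> Hc by (rule run[OF \<epsilon> T])
        have "large_gaps K" using gaps by (simp add: large_gaps_def)
        then show "(\<forall>k<K. terminates k) \<and>
          weak_gap Z F (average K)
            \<le> C1 * (enn2real (M_const p D Hc \<epsilon> \<nu>) * D ^ (p + 1) / real K powr (real (p + 1) / 2)) \<and>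
          weak_gap Z F (average K)
            \<le> C2 * (?L powr (real p / ?q) * D powr (real p + 1 + ?e)
                    / (\<epsilon> powr ?e * real K powr (real (p + 1) / 2)))"
          unfolding C2_def C1_def
          using terminates_if_large_gaps weak_gap_bound weak_gap_bound_explicit K by blast
      qed
      show ?b
      proof (cases "\<exists>\<epsilon>>0. admissible p D Hc \<epsilon> H0")
        \<comment> \<open>If \<open>H0\<close> is admissible for no accuracy, part (b) is vacuous
          and any threshold serves.\<close>
        case False
        then show ?thesis by (intro exI[of _ 1]) auto
      next
        case True
        then have L: "?L > 0" and H0: "H0 > 0"
          using admissible_holder_pos[where \<nu> = \<nu> and Hc = Hc, OF assms D(1) holder(2)]
          by (auto simp: admissible_def)
        \<comment> \<open>Chosen so that \<open>M_const\<close> divided by \<open>H0\<close> is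
          \<open>A / \<epsilon> powr ?e\<close>. For \<open>\<epsilon> \<le> 1\<close> this is at
          most \<open>A / \<epsilon>\<close>, because \<open>?e \<le> 1\<close>.\<close>
        define A where "A = 2 * ?C * (3 * ?C) powr ?e * ?L powr (real p / ?q) * D powr ?e / H0"
        have A: "A > 0" using C L D(1) H0 by (simp add: A_def)
        obtain \<epsilon>0 where \<epsilon>0: "\<epsilon>0 > 0" "\<And>\<epsilon>. 0 < \<epsilon> \<Longrightarrow> \<epsilon> < \<epsilon>0 \<Longrightarrow>
            1 \<le> ?Y \<epsilon> \<and> log 2 (A / \<epsilon>) \<le> ?Y \<epsilon> \<and> \<epsilon> \<le> 1"
          using log_le_powr_near_0[OF A _ s,
            of "?L powr ?s * D powr (2 + 2 * (1 - \<nu>) / ((real p + 1) * ?q))"] L D(1) by auto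
        have "\<exists>K\<ge>1. c * ?Y \<epsilon> \<le> real K \<and> 2 * real K + log 2 (enn2real (M_const p D Hc \<epsilon> \<nu>) / H0) \<le> C3 * ?Y \<epsilon>"
          if \<epsilon>: "0 < \<epsilon>" "\<epsilon> < \<epsilon>0" for \<epsilon>
        proof -
          define m where "m = log 2 (enn2real (M_const p D Hc \<epsilon> \<nu>) / H0)"
          define y where "y = ?Y \<epsilon>"
          have Y: "1 \<le> y" "log 2 (A / \<epsilon>) \<le> y" "\<epsilon> \<le> 1" 
            using \<epsilon>0(2)[OF \<epsilon>] unfolding y_def by auto
          \<comment> \<open>The least number of iterations that \<open>iterations_suffice\<close>
            permits; it is fixed before the selection \<open>T\<close> enters.\<close>
          define K where "K = nat \<lceil>c * y\<rceil>"
          have "y > 0" using Y(1) by linarith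
          with pos(3) have cY: "c * y > 0" by (rule mult_pos_pos)
          then have K: "1 \<le> K" "c * y \<le> real K" "real K \<le> c * y + 1"
            unfolding K_def by linarith+
          have "\<epsilon> powr 1 \<le> \<epsilon> powr ?e"
            using \<epsilon> Y(3) e by (intro powr_mono') auto
          then have "A / \<epsilon> powr ?e \<le> A / \<epsilon>"
            using A \<epsilon> by (intro divide_left_mono) auto
          moreover have "enn2real (M_const p D Hc \<epsilon> \<nu>) / H0 = A / \<epsilon> powr ?e"
            unfolding A_def M_const_explicit[where \<nu> = \<nu> and Hc = Hc, OF assms D(1) holder(2) L \<epsilon>(1)] by simp
          ultimately have "m \<le> log 2 (A / \<epsilon>)"
            unfolding m_def using A \<epsilon> by simp
          then have "m \<le> y" using Y(2) by (rule order_trans)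
          moreover have "2 * real K \<le> 2 * (c * y + 1)" using K(3) by simp
          ultimately have "2 * real K + m \<le> 2 * (c * y + 1) + y" by (rule add_mono[rotated])
          also have "\<dots> \<le> C3 * y"
            using Y(1) by (simp add: C3_def algebra_simps)
          finally show ?thesis using K unfolding y_def m_def by blast
        qed
        note K_ex = this
        show ?thesis
        proof (rule exI[of _ \<epsilon>0], rule conjI[OF \<epsilon>0(1)], intro allI impI, elim conjE)
          fix \<epsilon> assume \<epsilon>: "0 < \<epsilon>" "\<epsilon> < \<epsilon>0" and adm: "admissible p D Hc \<epsilon> H0"
          obtain K where K: "K \<ge> 1" "c * ?Y \<epsilon> \<le> real K"
            "2 * real K + log 2 (enn2real (M_const p D Hc \<epsilon> \<nu>) / H0) \<le> C3 * ?Y \<epsilon>"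
            using K_ex[OF \<epsilon>] by blast
          note gap = iterations_suffice[OF assms(1,2) pos(2) L D(1) \<epsilon>(1) K(2)[unfolded c_def]]
          show "\<exists>K\<ge>1. \<forall>T. model_solver Z p DF T \<longrightarrow>
            (let N = C3 * ?Y \<epsilon>
             in (\<exists>k<K. \<exists>i. uteg.generated Z p F DF T z0 H0 k i \<and>
                   real (uteg.calls Z p F DF T z0 H0 k + i + 1) \<le> N \<and>
                   weak_solution Z F \<epsilon> (uteg.trial Z p F DF T z0 H0 k i)) \<or>
                ((\<forall>k<K. uteg.terminates Z p F DF T z0 H0 k) \<and>
                 real (uteg.calls Z p F DF T z0 H0 K) \<le> N \<and>
                 weak_solution Z F \<epsilon> (uteg.average Z p F DF T z0 H0 K)))"
            unfolding Let_def
          proof (rule exI[of _ K], rule conjI[OF K(1)], intro allI impI)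
            fix T assume T: "model_solver Z p DF T"
            interpret uteg_run Z p F DF T z0 H0 d \<nu> D \<epsilon> Hc by (rule run[OF \<epsilon>(1) adm T])
            show "(\<exists>k<K. \<exists>i. generated k i \<and> real (calls k + i + 1) \<le> C3 * ?Y \<epsilon> \<and>
                weak_solution Z F \<epsilon> (trial k i)) \<or>
              ((\<forall>k<K. terminates k) \<and> real (calls K) \<le> C3 * ?Y \<epsilon> \<and> weak_solution Z F \<epsilon> (average K))"
              by (rule weak_solution_within_calls[OF K(1) gap[unfolded C2_def C1_def] K(3)])
          qed
        qed
      qed
    qed
  qed
qed

end
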